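(* Let $(x^0,c)\in\mathcal{F}\times\mathbb{R}^n$, set $f(x)=\langle c,x\rangle$, and define $$v=-d\phi_h(x^0)^{-1}\Pi_{\mathcal{A}_0}c=-\sqrt{H(x^0)^{-1}}\,\Pi_{\sqrt{H(x^0)}\mathcal{A}_0}\sqrt{H(x^0)^{-1}}\,\Pi_{\mathcal{A}_0}c.$$ If $\mathcal{F}$ is endowed with the metric $(\cdot,\cdot)^{H^2}=(\phi_h)^*\langle\cdot,\cdot\rangle$, i.e. $(u,w)^{H^2}_x=\langle\Pi_{\mathcal{A}_0}H(x)u,\Pi_{\mathcal{A}_0}H(x)w\rangle$ for $x\in\mathcal{F}$ and $u,w\in\mathcal{A}_0$, then the solution $x(t)$ of $(H\text{-}SD)$, $$\dot x(t)+\nabla_Hf_{|\mathcal{F}}(x(t))=0,\quad x(0)=x^0,$$ is the unique geodesic passing through $x^0$ with velocity $v$.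
   Context: Let $m<n$ be positive integers, $A\in\mathbb{R}^{m\times n}$ of full rank, $b\in\operatorname{Im}A$, $\mathcal{A}=\{x\in\mathbb{R}^n: Ax=b\}$, $\mathcal{A}_0=\ker A$. Let $C\subset\mathbb{R}^n$ be nonempty, open and convex, with $\mathcal{F}=C\cap\mathcal{A}\neq\emptyset$. For a linear subspace $E$, $\Pi_E$ is the Euclidean orthogonal projection onto $E$. $\Gamma_0(\mathbb{R}^n)$ is the set of lower semicontinuous proper convex functions $\mathbb{R}^n\to\mathbb{R}\cup\{+\infty\}$. A function $h\in\Gamma_0(\mathbb{R}^n)$ is of Legendre type if it is differentiable on $\operatorname{int}\operatorname{dom}h$, $|\nabla h(x^j)|\to+\infty$ for every sequence $(x^j)\subset\operatorname{int}\operatorname{dom}h$ converging to a boundary point of $\operatorname{dom}h$, and $h$ is strictly convex on $\operatorname{int}\operatorname{dom}h$. The function $h\in\Gamma_0(\mathbb{R}^n)$ is assumed to satisfy: (i) $h$ is of Legendre type with $\operatorname{int}\operatorname{dom}h=C$; (ii) $h_{|C}\in\mathcal{C}^2(C;\mathbb{R})$ and $\nabla^2h(x)$ is symmetric positive definite for all $x\in C$; (iii) $x\mapsto\nabla^2h(x)$ is locally Lipschitz continuous on $C$. Set $H=\nabla^2h$ on $C$. $\nabla_Hf_{|\mathcal{F}}(x)=H(x)^{-1}[I-A^T(AH(x)^{-1}A^T)^{-1}AH(x)^{-1}]\nabla f(x)$ is the gradient of $f_{|\mathcal{F}}$ for the Riemannian metric $(u,w)^H_x=\langle H(x)u,w\rangle$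 on $\mathcal{F}$ (tangent space $\mathcal{A}_0$). The Legendre transform coordinates mapping is $\phi_h:\mathcal{F}\to\mathcal{F}^*=\phi_h(\mathcal{F})\subset\mathcal{A}_0$, $\phi_h(x)=\Pi_{\mathcal{A}_0}\nabla h(x)$. It is a $\mathcal{C}^1$ diffeomorphism onto $\mathcal{F}^*$, an open convex subset of $\mathcal{A}_0$, with $d\phi_h(x)=\Pi_{\mathcal{A}_0}H(x)$ on $\mathcal{A}_0$. By definition of the metric $(\cdot,\cdot)^{H^2}$, $\phi_h$ is an isometry from $\mathcal{F}$ onto $\mathcal{F}^*$ endowed with the Euclidean metric, so that geodesics of $\mathcal{F}$ are the curves $\gamma$ for which $\phi_h\circ\gamma$ is a geodesic (affinely parametrized straight line) of $\mathcal{F}^*$. The geodesic through $x^0$ with velocity $v$ means the maximal geodesic $\gamma$ with $\gamma(0)=x^0$, $\dot\gamma(0)=v$, and $x(t)$ is the maximal solution of $(H\text{-}SD)$. *)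

theory Defs
  imports "HOL-Analysis.Analysis"
begin

section \<open>Linear algebra\<close>

definition ker :: "real^'n^'m \<Rightarrow> (real^'n) set" where
  "ker A = {u. A *v u = 0}"

definition orth_proj :: "(real^'n) set \<Rightarrow> real^'n \<Rightarrow> real^'n" where
  "orth_proj E x = (THE y. y \<in> E \<and> (\<forall>w\<in>E. orthogonal (x - y) w))"

definition sym_matrix :: "real^'n^'n \<Rightarrow> bool" where
  "sym_matrix M \<longleftrightarrow> transpose M = M"

definition pos_def_matrix :: "real^'n^'n \<Rightarrow> bool" where
  "pos_def_matrix M \<longleftrightarrow> sym_matrix M \<and> (\<forall>u. u \<noteq> 0 \<longrightarrow> (M *v u) \<bullet> u > 0)"

definition matrix_sqrt :: "real^'n^'n \<Rightarrow> real^'n^'n" where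
  "matrix_sqrt M = (THE S. sym_matrix S \<and> (\<forall>u. (S *v u) \<bullet> u \<ge> 0) \<and> S ** S = M)"

section \<open>Gradient and Hessian\<close>

definition gradient :: "(real^'n \<Rightarrow> real) \<Rightarrow> real^'n \<Rightarrow> real^'n" where
  "gradient f x = (THE D. GDERIV f x :> D)"

definition hessian :: "(real^'n \<Rightarrow> real) \<Rightarrow> real^'n \<Rightarrow> real^'n^'n" where
  "hessian f x = matrix (frechet_derivative (gradient f) (at x))"

definition C2_on :: "(real^'n) set \<Rightarrow> (real^'n \<Rightarrow> real) \<Rightarrow> bool" where
  "C2_on U f \<longleftrightarrow> (\<forall>x\<in>U. f differentiable (at x)) \<and>
     (\<forall>x\<in>U. gradient f differentiable (at x)) \<and> continuous_on U (hessian f)"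

definition locally_lipschitz_on ::
    "('a::metric_space) set \<Rightarrow> ('a \<Rightarrow> 'b::metric_space) \<Rightarrow> bool" where
  "locally_lipschitz_on U F \<longleftrightarrow> (\<forall>x\<in>U. \<exists>r>0. \<exists>L. L-lipschitz_on (ball x r \<inter> U) F)"

section \<open>Extended-valued convex functions\<close>

definition edom :: "('a \<Rightarrow> ereal) \<Rightarrow> 'a set" where
  "edom h = {x. h x < \<infinity>}"

text \<open>The real-valued function underlying \<open>h\<close>; only its values on \<open>edom h\<close> are meaningful.
  Derivatives are taken at interior points of \<open>edom h\<close> only.\<close>

definition fin_part :: "('a \<Rightarrow> ereal) \<Rightarrow> 'a \<Rightarrow> real" where
  "fin_part h x = real_of_ereal (h x)"

text \<open>In the convexity inequality, the conventions \<open>0 * \<infinity> = 0\<close> of \<^typ>\<open>ereal\<close> are harmless: at the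
  end points it reads \<open>h x \<le> h x\<close>. No value is \<open>-\<infinity>\<close>, so all sums are well defined.\<close>

definition Gamma0 :: "(real^'n \<Rightarrow> ereal) set" where
  "Gamma0 = {h. (\<forall>x. h x \<noteq> -\<infinity>) \<and> edom h \<noteq> {} \<and>
     (\<forall>x y t. 0 \<le> t \<and> t \<le> 1 \<longrightarrow>
        h ((1 - t) *\<^sub>R x + t *\<^sub>R y) \<le> ereal (1 - t) * h x + ereal t * h y) \<and>
     (\<forall>x. h x \<le> Liminf (at x) h)}"

definition legendre_type :: "(real^'n \<Rightarrow> ereal) \<Rightarrow> bool" where
  "legendre_type h \<longleftrightarrow>
     (\<forall>x\<in>interior (edom h). fin_part h differentiable (at x)) \<and>
     (\<forall>X y. (\<forall>j::nat. X j \<in> interior (edom h)) \<and> y \<in> frontier (edom h) \<and> X \<longlonglongrightarrow> y \<longrightarrow>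
        filterlim (\<lambda>j. norm (gradient (fin_part h) (X j))) at_top sequentially) \<and>
     (\<forall>x\<in>interior (edom h). \<forall>y\<in>interior (edom h). \<forall>t. x \<noteq> y \<and> 0 < t \<and> t < 1 \<longrightarrow>
        fin_part h ((1 - t) *\<^sub>R x + t *\<^sub>R y) < (1 - t) * fin_part h x + t * fin_part h y)"

section \<open>The feasible set and the Riemannian gradient\<close>

definition feasible :: "real^'n^'m \<Rightarrow> real^'m \<Rightarrow> (real^'n) set \<Rightarrow> (real^'n) set" where
  "feasible A b C = C \<inter> {x. A *v x = b}"

abbreviation Hess :: "(real^'n \<Rightarrow> ereal) \<Rightarrow> real^'n \<Rightarrow> real^'n^'n" where
  "Hess h \<equiv> hessian (fin_part h)"

definition riem_grad ::
    "real^'n^'m \<Rightarrow> (real^'n \<Rightarrow> real^'n^'n) \<Rightarrow> (real^'n \<Rightarrow> real) \<Rightarrow> real^'n \<Rightarrow> real^'n" where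
  "riem_grad A H f x =
     (let Hi = matrix_inv (H x) in
       Hi *v ((mat 1 - transpose A ** matrix_inv (A ** Hi ** transpose A) ** A ** Hi)
                *v gradient f x))"

section \<open>Curves on open intervals, and the system H-SD\<close>

definition maximal_curve :: "(real set \<Rightarrow> (real \<Rightarrow> 'a) \<Rightarrow> bool) \<Rightarrow> real set \<Rightarrow> (real \<Rightarrow> 'a) \<Rightarrow> bool" where
  "maximal_curve P I x \<longleftrightarrow>
     P I x \<and> (\<forall>J y. P J y \<and> I \<subseteq> J \<and> (\<forall>t\<in>I. y t = x t) \<longrightarrow> J = I)"

definition HSD_solution ::
    "real^'n^'m \<Rightarrow> real^'m \<Rightarrow> (real^'n) set \<Rightarrow> (real^'n \<Rightarrow> ereal) \<Rightarrow> (real^'n \<Rightarrow> real) \<Rightarrow> real^'n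
      \<Rightarrow> real set \<Rightarrow> (real \<Rightarrow> real^'n) \<Rightarrow> bool" where
  "HSD_solution A b C h f x0 I x \<longleftrightarrow>
     open I \<and> is_interval I \<and> 0 \<in> I \<and> x 0 = x0 \<and>
     (\<forall>t\<in>I. x t \<in> feasible A b C \<and>
        (x has_vector_derivative - riem_grad A (Hess h) f (x t)) (at t))"

section \<open>Geodesics\<close>

text \<open>
  A metric on \<open>M\<close> is given by the family of bilinear forms \<open>g x u w\<close>, for \<open>x \<in> M\<close> and \<open>u\<close>, \<open>w\<close>
  tangent to \<open>M\<close>. The metric of interest is merely continuous (it is built from second
  derivatives of \<open>h\<close> that are locally Lipschitz), so Christoffel symbols are not available.
  Geodesics are therefore the \<open>C\<^sup>1\<close> curves of constant speed which locally minimize the length.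
  Competitors are \<open>C\<^sup>1\<close> up to the end points, so the integrand in their length is continuous; since
  length does not depend on the parametrization, it is enough to consider competitors which are
  parametrized by the same interval.
\<close>

type_synonym 'a metric = "'a \<Rightarrow> 'a \<Rightarrow> 'a \<Rightarrow> real"

definition curve_speed :: "'a::real_normed_vector metric \<Rightarrow> (real \<Rightarrow> 'a) \<Rightarrow> real \<Rightarrow> real" where
  "curve_speed g \<gamma> t =
     sqrt (g (\<gamma> t) (vector_derivative \<gamma> (at t)) (vector_derivative \<gamma> (at t)))"

definition curve_length :: "'a::real_normed_vector metric \<Rightarrow> real \<Rightarrow> real \<Rightarrow> (real \<Rightarrow> 'a) \<Rightarrow> real" where
  "curve_length g s t \<gamma> = integral {s..t} (curve_speed g \<gamma>)"

definition geodesic ::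
    "'a::real_normed_vector set \<Rightarrow> 'a metric \<Rightarrow> real set \<Rightarrow> (real \<Rightarrow> 'a) \<Rightarrow> bool" where
  "geodesic M g J \<gamma> \<longleftrightarrow>
     open J \<and> is_interval J \<and> \<gamma> ` J \<subseteq> M \<and> \<gamma> C1_differentiable_on J \<and>
     (\<exists>k. \<forall>t\<in>J. curve_speed g \<gamma> t = k) \<and>
     (\<forall>t\<in>J. \<exists>e>0. \<forall>s r. s < r \<and> {s..r} \<subseteq> J \<inter> ball t e \<longrightarrow>
        (\<forall>p. p C1_differentiable_on {s..r} \<and> p ` {s..r} \<subseteq> M \<and> p s = \<gamma> s \<and> p r = \<gamma> r \<longrightarrow>
           curve_length g s r \<gamma> \<le> curve_length g s r p))"

definition geodesic_through ::
    "'a::real_normed_vector set \<Rightarrow> 'a metric \<Rightarrow> 'a \<Rightarrow> 'a \<Rightarrow> real set \<Rightarrow> (real \<Rightarrow> 'a) \<Rightarrow> bool" where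
  "geodesic_through M g x0 v J \<gamma> \<longleftrightarrow>
     geodesic M g J \<gamma> \<and> 0 \<in> J \<and> \<gamma> 0 = x0 \<and> (\<gamma> has_vector_derivative v) (at 0)"

section \<open>Legendre transform coordinates\<close>

text \<open>The defining formula of \<open>legendre_coord A h\<close> makes sense on the whole open set \<open>C\<close>. The
  differential of its restriction to the feasible set is the restriction of \<open>d_legendre_coord\<close> to
  the tangent space \<open>ker A\<close>, which is how \<open>d_legendre_coord\<close> is to be used.\<close>

definition legendre_coord :: "real^'n^'m \<Rightarrow> (real^'n \<Rightarrow> ereal) \<Rightarrow> real^'n \<Rightarrow> real^'n" where
  "legendre_coord A h x = orth_proj (ker A) (gradient (fin_part h) x)"

definition d_legendre_coord ::
    "real^'n^'m \<Rightarrow> (real^'n \<Rightarrow> ereal) \<Rightarrow> real^'n \<Rightarrow> real^'n \<Rightarrow> real^'n" where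
  "d_legendre_coord A h x = frechet_derivative (legendre_coord A h) (at x)"

definition H2_metric :: "real^'n^'m \<Rightarrow> (real^'n \<Rightarrow> ereal) \<Rightarrow> (real^'n) metric" where
  "H2_metric A h x u w =
     orth_proj (ker A) (Hess h x *v u) \<bullet> orth_proj (ker A) (Hess h x *v w)"

end

theory Submission
  imports Defs
begin

text \<open>
  Along a curve \<open>x\<close> in the feasible set, the Riemannian gradient is the tangent vector that
  \<open>d\<phi>\<close> maps to the projection of \<open>c\<close>. Hence \<open>x\<close> solves the steepest descent system iff \<open>\<phi> \<circ> x\<close> has
  the constant velocity \<open>- P c\<close>, where \<open>P\<close> projects onto \<open>ker A\<close>. In turn, \<open>d\<phi>\<close> takes the metric to the Euclidean one, and \<open>\<phi>\<close> has
  open image in \<open>ker A\<close>, so short chords of \<open>\<phi> \<circ> x\<close> lift to competitors in the feasible set: a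
  geodesic is locally as short as its chord, and its image under \<open>\<phi>\<close> has constant velocity.
  Geodesics through \<open>x0\<close> with velocity \<open>v\<close> and solutions from \<open>x0\<close> are therefore the same curves, also
  before any maximality is imposed, and injectivity of \<open>\<phi>\<close> lets two of them be glued.
\<close>

section \<open>Orthogonal projections\<close>

text \<open>Two candidates differ by an element of \<open>E\<close> that is orthogonal to
  itself.\<close>

lemma orth_proj_unique:
  assumes "subspace E" "y \<in> E" "\<And>w. w \<in> E \<Longrightarrow> (x - y) \<bullet> w = 0"
  shows "orth_proj E x = y"
  unfolding orth_proj_def
proof (rule the_equality)
  show "y \<in> E \<and> (\<forall>w\<in>E. orthogonal (x - y) w)"
    using assms by (simp add: orthogonal_def)
next
  fix z assume z: "z \<in> E \<and> (\<forall>w\<in>E. orthogonal (x - z) w)"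
  have "y - z \<in> E"
    using assms z by (simp add: subspace_diff)
  then have "(x - z) \<bullet> (y - z) - (x - y) \<bullet> (y - z) = 0"
    using z assms(3) by (simp add: orthogonal_def)
  then have "(y - z) \<bullet> (y - z) = 0"
    by (simp add: inner_diff_left)
  then show "z = y" by simp
qed

lemma orth_proj_decomp:
  assumes "subspace E"
  shows orth_proj_in: "orth_proj E x \<in> E"
    and orth_proj_diff_orthogonal: "w \<in> E \<Longrightarrow> (x - orth_proj E x) \<bullet> w = 0"
proof -
  obtain y z where yz: "y \<in> span E" "\<And>w. w \<in> span E \<Longrightarrow> orthogonal z w" "x = y + z"
    using orthogonal_subspace_decomp_exists[of E x] by blast
  have "span E = E" using assms by (simp add: span_eq_iff)
  with yz have y: "y \<in> E" "\<And>w. w \<in> E \<Longrightarrow> (x - y) \<bullet> w = 0"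
    by (auto simp: orthogonal_def)
  have "orth_proj E x = y"
    using orth_proj_unique[OF assms y] .
  with y show "orth_proj E x \<in> E" "w \<in> E \<Longrightarrow> (x - orth_proj E x) \<bullet> w = 0"
    by auto
qed

lemma orth_proj_inner:
  assumes "subspace E" "w \<in> E"
  shows "orth_proj E x \<bullet> w = x \<bullet> w"
  using orth_proj_diff_orthogonal[OF assms, of x] by (simp add: inner_diff_left)

lemma orth_proj_eq_0:
  assumes "subspace E" "\<And>w. w \<in> E \<Longrightarrow> x \<bullet> w = 0"
  shows "orth_proj E x = 0"
  using assms by (intro orth_proj_unique) (auto simp: subspace_0)

lemma linear_orth_proj:
  fixes E :: "(real^'n) set"
  assumes "subspace E"
  shows "linear (orth_proj E)"
proof (rule linearI)
  fix x y :: "real^'n" and r :: real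
  show "orth_proj E (x + y) = orth_proj E x + orth_proj E y"
    by (rule orth_proj_unique)
       (auto simp: assms subspace_add orth_proj_in inner_diff_left inner_add_left orth_proj_inner)
  show "orth_proj E (r *\<^sub>R x) = r *\<^sub>R orth_proj E x"
    by (rule orth_proj_unique)
       (auto simp: assms subspace_scale orth_proj_in inner_diff_left orth_proj_inner)
qed

lemma orth_proj_self:
  assumes "subspace E" "x \<in> E"
  shows "orth_proj E x = x"
  using assms by (intro orth_proj_unique) auto

section \<open>Square roots of positive definite matrices\<close>

text \<open>Cauchy-Schwarz for a semidefinite form: a vector on which the form vanishes lies in its
  radical. It serves both for the extremal eigenvector and for uniqueness of square roots.\<close>

lemma semidefinite_form_isotropic:
  fixes f :: "'a::real_inner \<Rightarrow> 'a"
  assumes f: "linear f" and sym: "\<And>x y. f x \<bullet> y = x \<bullet> f y"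
    and S: "subspace S" and nonneg: "\<And>x. x \<in> S \<Longrightarrow> f x \<bullet> x \<ge> 0"
    and u: "u \<in> S" "f u \<bullet> u = 0" and w: "w \<in> S"
  shows "f u \<bullet> w = 0"
proof (rule ccontr)
  assume ne: "f u \<bullet> w \<noteq> 0"
  define a k where "a = f u \<bullet> w" and "k = f w \<bullet> w"
  have k: "k \<ge> 0" using nonneg[OF w] by (simp add: k_def)
  \<comment> \<open>The form at \<open>u + t w\<close> equals \<open>2 t a + t^2 k\<close>. This
    \<open>t\<close> turns it into \<open>- t^2 (k + 2)\<close>, and the \<open>+ 1\<close> keeps
    the denominator positive when \<open>k = 0\<close>.\<close>
  define t where "t = - a / (k + 1)"
  have "u + t *\<^sub>R w \<in> S" using S u w by (simp add: subspace_add subspace_scale)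
  then have "0 \<le> f (u + t *\<^sub>R w) \<bullet> (u + t *\<^sub>R w)" by (rule nonneg)
  also have "\<dots> = 2 * t * a + t * t * k"
    using u(2) sym[of w u]
    by (simp add: linear_add[OF f] linear_scale[OF f] inner_add_left inner_add_right a_def k_def
        inner_commute algebra_simps)
  also have "\<dots> = - ((t * t) * (k + 2))"
  proof -
    have "a = - (t * (k + 1))" using k by (simp add: t_def)
    then show ?thesis by algebra
  qed
  also have "\<dots> < 0"
  proof -
    have "t \<noteq> 0" using k ne by (simp add: t_def a_def)
    then have "t * t > 0" by (metis not_real_square_gt_zero)
    then have "(t * t) * (k + 2) > 0" using k mult_pos_pos[of "t * t" "k + 2"] by linarith
    then show ?thesis by linarith
  qed
  finally show False by simp
qed

text \<open>The spectral theorem by induction on the dimension of an invariant subspace: a maximizer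
  of the Rayleigh quotient is an eigenvector, and its orthogonal complement is again
  invariant.\<close>

lemma symmetric_operator_eigenbasis:
  fixes f :: "'a::euclidean_space \<Rightarrow> 'a"
  assumes f: "linear f" and sym: "\<And>x y. f x \<bullet> y = x \<bullet> f y"
    and "subspace S" "f ` S \<subseteq> S"
  shows "\<exists>B. finite B \<and> pairwise orthogonal B \<and> (\<forall>b\<in>B. norm b = 1) \<and> span B = S
           \<and> (\<forall>b\<in>B. f b = (f b \<bullet> b) *\<^sub>R b)"
  using assms(3,4)
proof (induction "dim S" arbitrary: S rule: less_induct)
  case less
  show ?case
  proof (cases "S = {0}")
    case True
    then show ?thesis by (intro exI[of _ "{}"]) auto
  next
    case False
    then obtain u where u: "u \<in> S" "u \<noteq> 0"
      using subspace_0[OF less.prems(1)] by blast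
    define K where "K = S \<inter> sphere 0 1"
    have "compact K"
      unfolding K_def using closed_subspace[OF less.prems(1)]
      by (simp add: closed_Int_compact)
    moreover have "(1 / norm u) *\<^sub>R u \<in> K"
      using u less.prems(1) by (simp add: K_def subspace_scale)
    then have "K \<noteq> {}" by blast
    moreover have "continuous_on K (\<lambda>x. f x \<bullet> x)"
      by (intro continuous_intros linear_continuous_on linear_conv_bounded_linear[THEN iffD1] f)
    ultimately obtain e where e: "e \<in> K" "\<And>x. x \<in> K \<Longrightarrow> f x \<bullet> x \<le> f e \<bullet> e"
      using continuous_attains_sup[of K "\<lambda>x. f x \<bullet> x"] by blast
    have eS: "e \<in> S" and ee: "norm e = 1" "e \<bullet> e = 1"
      using e(1) by (auto simp: K_def norm_eq_1)
    define l where "l = f e \<bullet> e"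
    \<comment> \<open>Maximality of \<open>l\<close> makes the form of \<open>g\<close> nonnegative
      on \<open>S\<close>, and it vanishes at \<open>e\<close>. Hence \<open>g e\<close> is
      orthogonal to all of \<open>S\<close>, in particular to itself, so \<open>e\<close> is an
      eigenvector.\<close>
    define g where "g = (\<lambda>x. l *\<^sub>R x - f x)"
    have g: "linear g"
      by (rule linearI) (simp_all add: g_def linear_add[OF f] linear_scale[OF f] algebra_simps)
    have gsym: "g x \<bullet> y = x \<bullet> g y" for x y
      by (simp add: g_def inner_diff_left inner_diff_right sym)
    have gnn: "g x \<bullet> x \<ge> 0" if "x \<in> S" for x
    proof (cases "x = 0")
      case False
      define y where "y = (1 / norm x) *\<^sub>R x"
      have "norm y = 1" using False by (simp add: y_def)
      moreover have "y \<in> S" unfolding y_def using that less.prems(1) by (rule subspace_scale[rotated])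
      ultimately have "y \<in> K" by (simp add: K_def)
      then have "f y \<bullet> y \<le> l" using e(2) l_def by simp
      moreover have x: "x = norm x *\<^sub>R y" using False by (simp add: y_def)
      have "f x \<bullet> x = (norm x)\<^sup>2 * (f y \<bullet> y)"
        by (subst (1 2) x) (simp only: linear_scale[OF f] inner_scaleR_left inner_scaleR_right
            power2_eq_square mult.assoc)
      ultimately have "f x \<bullet> x \<le> (norm x)\<^sup>2 * l"
        by (simp add: mult_left_mono)
      then show ?thesis
        by (simp add: g_def inner_diff_left power2_norm_eq_inner mult.commute)
    qed (simp add: g_def)
    have ge: "g e \<in> S"
      using less.prems eS by (auto simp: g_def intro!: subspace_diff subspace_scale)
    have "g e \<bullet> g e = 0"
      by (rule semidefinite_form_isotropic[OF g gsym less.prems(1) gnn eS _ ge])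
         (simp_all add: g_def inner_diff_left l_def ee)
    then have fe: "f e = l *\<^sub>R e" by (simp add: g_def)
    define T where "T = {x \<in> S. e \<bullet> x = 0}"
    have T: "subspace T"
      using less.prems(1) by (auto simp: T_def subspace_def inner_add_right)
    have fT: "f ` T \<subseteq> T"
    proof -
      have "e \<bullet> f x = 0" if "e \<bullet> x = 0" for x
        using sym[of e x] that fe by simp
      then show ?thesis using less.prems(2) by (auto simp: T_def)
    qed
    have "T \<subseteq> S" "e \<notin> T" by (auto simp: T_def ee)
    then have "T \<subset> S" using eS by blast
    then have "span T \<subset> span S"
      using T less.prems(1) by (simp add: span_eq_iff[THEN iffD2])
    then have "dim T < dim S" by (rule dim_psubset)
    from less.hyps[OF this T fT] obtain B where B: "finite B" "pairwise orthogonal B"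
      "\<forall>b\<in>B. norm b = 1" "span B = T" "\<forall>b\<in>B. f b = (f b \<bullet> b) *\<^sub>R b"
      by blast
    have BT: "B \<subseteq> T" using B(4) span_superset by blast
    show ?thesis
    proof (intro exI[of _ "insert e B"] conjI)
      show "finite (insert e B)" using B by simp
      show "pairwise orthogonal (insert e B)"
        using B(2) BT by (auto simp: pairwise_insert T_def orthogonal_def inner_commute)
      show "\<forall>b\<in>insert e B. norm b = 1" using B(3) ee by simp
      show "\<forall>b\<in>insert e B. f b = (f b \<bullet> b) *\<^sub>R b"
        using B(5) fe ee by (simp add: l_def[symmetric])
      show "span (insert e B) = S"
      proof
        show "span (insert e B) \<subseteq> S"
          using BT \<open>T \<subseteq> S\<close> eS less.prems(1) by (intro span_minimal) auto
        show "S \<subseteq> span (insert e B)"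
        proof
          fix x assume x: "x \<in> S"
          define y where "y = x - (e \<bullet> x) *\<^sub>R e"
          have "y \<in> T" using x eS less.prems(1) ee
            by (simp add: y_def T_def subspace_diff subspace_scale inner_diff_right)
          then have "y \<in> span (insert e B)"
            using B(4) span_mono[of B "insert e B"] by blast
          moreover have "e \<in> span (insert e B)" by (simp add: span_base)
          ultimately have "y + (e \<bullet> x) *\<^sub>R e \<in> span (insert e B)"
            by (intro span_add span_scale)
          then show "x \<in> span (insert e B)" by (simp add: y_def)
        qed
      qed
    qed
  qed
qed

section \<open>Existence and uniqueness of the nonnegative root\<close>

lemma sym_matrix_inner: "sym_matrix M \<Longrightarrow> (M *v x) \<bullet> y = x \<bullet> (M *v y)"
  by (metis dot_lmul_matrix sym_matrix_def vector_transpose_matrix)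

lemma sym_matrixI:
  assumes "\<And>x y. (M *v x) \<bullet> y = x \<bullet> (M *v y)"
  shows "sym_matrix M"
proof -
  have "transpose M *v y = M *v y" for y
  proof (rule vector_eq_ldot[THEN iffD1], rule allI)
    fix x
    show "x \<bullet> (transpose M *v y) = x \<bullet> (M *v y)"
      using assms[of x y] dot_lmul_matrix[of y M x]
      by (simp add: inner_commute) 
  qed
  then show ?thesis by (simp add: sym_matrix_def matrix_eq)
qed

text \<open>Keep an orthonormal eigenbasis and replace each eigenvalue by its square root.\<close>

lemma sqrt_matrix_exists:
  assumes M: "sym_matrix M" and nonneg: "\<And>u. (M *v u) \<bullet> u \<ge> 0"
  shows "\<exists>S. sym_matrix S \<and> (\<forall>u. (S *v u) \<bullet> u \<ge> 0) \<and> S ** S = M"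
proof -
  obtain B where B: "finite B" "pairwise orthogonal B" "\<And>b. b \<in> B \<Longrightarrow> norm b = 1"
      "span B = UNIV" "\<And>b. b \<in> B \<Longrightarrow> M *v b = ((M *v b) \<bullet> b) *\<^sub>R b"
    using symmetric_operator_eigenbasis[of "(*v) M" UNIV] sym_matrix_inner[OF M] by auto
  define l where "l b = sqrt ((M *v b) \<bullet> b)" for b
  have ll: "l b * l b = (M *v b) \<bullet> b" and l0: "l b \<ge> 0" for b
    using nonneg[of b] by (auto simp: l_def)
  define s where "s x = (\<Sum>b\<in>B. (l b * (x \<bullet> b)) *\<^sub>R b)" for x
  have s: "linear s"
    unfolding s_def by (intro linearI)
      (simp_all add: inner_add_left sum.distrib scaleR_sum_right algebra_simps)
  have expand: "(\<Sum>b\<in>B. (x \<bullet> b) *\<^sub>R b) = x" for x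
    using B by (intro orthonormal_basis_expand) auto
  have sb: "s b = l b *\<^sub>R b" if b: "b \<in> B" for b
  proof -
    have "s b = (\<Sum>a\<in>B. if a = b then l b *\<^sub>R b else 0)"
      unfolding s_def
    proof (rule sum.cong)
      fix a assume a: "a \<in> B"
      have "b \<bullet> a = (if a = b then 1 else 0)"
        using B(2,3) a b by (auto simp: pairwise_def orthogonal_def norm_eq_1 inner_commute)
      then show "(l a * (b \<bullet> a)) *\<^sub>R a = (if a = b then l b *\<^sub>R b else 0)" by auto
    qed simp
    then show ?thesis using B(1) b by simp
  qed
  have ss: "s (s x) = M *v x" for x
  proof -
    have "s (s x) = (\<Sum>b\<in>B. (l b * (x \<bullet> b)) *\<^sub>R s b)"
      by (subst s_def[of x]) (simp add: linear_sum[OF s] linear_scale[OF s])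
    also have "\<dots> = (\<Sum>b\<in>B. (x \<bullet> b) *\<^sub>R (M *v b))"
    proof (rule sum.cong)
      fix b assume b: "b \<in> B"
      show "(l b * (x \<bullet> b)) *\<^sub>R s b = (x \<bullet> b) *\<^sub>R (M *v b)"
        by (subst B(5)[OF b]) (simp add: sb[OF b] ll[symmetric] mult_ac)
    qed simp
    also have "\<dots> = M *v (\<Sum>b\<in>B. (x \<bullet> b) *\<^sub>R b)"
      by (simp add: linear_sum[OF matrix_vector_mul_linear] matrix_vector_mult_scaleR)
    finally show ?thesis by (simp add: expand)
  qed
  have sxy: "s x \<bullet> y = (\<Sum>b\<in>B. l b * (x \<bullet> b) * (y \<bullet> b))" for x y
    by (simp add: s_def inner_sum_left) (simp add: inner_commute)
  have ms: "matrix s *v x = s x" for x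
    by (rule matrix_works) (use s in \<open>simp add: linear_matrix_vector_mul_eq\<close>)
  show ?thesis
  proof (intro exI[of _ "matrix s"] conjI allI)
    show "sym_matrix (matrix s)"
      by (rule sym_matrixI) (simp add: ms sxy inner_commute[of _ "s _"] mult_ac)
    show "(matrix s *v u) \<bullet> u \<ge> 0" for u
      by (simp add: ms sxy mult.assoc l0 sum_nonneg)
    show "matrix s ** matrix s = M"
      by (simp add: matrix_eq matrix_vector_mul_assoc[symmetric] ms ss)
  qed
qed

lemma matrix_inv_mult:
  assumes "invertible M"
  shows "M ** matrix_inv M = mat 1" "matrix_inv M ** M = mat 1"
  using assms someI_ex[of "\<lambda>N. M ** N = mat 1 \<and> N ** M = mat 1"]
  by (auto simp: invertible_def matrix_inv_def)

lemma pos_def_matrix_invertible: "pos_def_matrix M \<Longrightarrow> invertible M"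
  by (metis inner_zero_left invertible_left_inverse less_irrefl matrix_left_invertible_ker pos_def_matrix_def)

lemma pos_def_matrix_inv:
  assumes "pos_def_matrix M"
  shows "pos_def_matrix (matrix_inv M)"
  unfolding pos_def_matrix_def
proof (intro conjI allI impI sym_matrixI)
  note inv = matrix_inv_mult[OF pos_def_matrix_invertible[OF assms]]
  have M: "M *v (matrix_inv M *v x) = x" for x
    by (simp add: matrix_vector_mul_assoc inv)
  have sym: "sym_matrix M" using assms by (simp add: pos_def_matrix_def)
  show "(matrix_inv M *v x) \<bullet> y = x \<bullet> (matrix_inv M *v y)" for x y
    using sym_matrix_inner[OF sym, of "matrix_inv M *v x" "matrix_inv M *v y"] by (simp add: M)
  fix u :: "real^'a" assume "u \<noteq> 0"
  then have "matrix_inv M *v u \<noteq> 0" using M[of u] by auto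
  then show "(matrix_inv M *v u) \<bullet> u > 0"
    using assms M[of u] by (metis inner_commute pos_def_matrix_def)
qed

text \<open>With \<open>D = S - T\<close>, equality of squares reads \<open>S D + D T = 0\<close>.
  Multiplying by \<open>D\<close> and taking traces gives two nonnegative numbers with sum zero, so
  the form of \<open>S\<close> vanishes on the columns of \<open>D\<close>. Then \<open>S\<close>,
  hence \<open>M\<close>, kills these columns, and \<open>D = 0\<close>.\<close>

lemma sqrt_matrix_unique:
  assumes M: "pos_def_matrix M"
    and S: "sym_matrix S" "\<And>u. (S *v u) \<bullet> u \<ge> 0" "S ** S = M"
    and T: "sym_matrix T" "\<And>u. (T *v u) \<bullet> u \<ge> 0" "T ** T = M"
  shows "S = T"
proof -
  define D where "D = S - T"
  have Dv: "D *v x = S *v x - T *v x" for x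
    by (simp add: D_def matrix_vector_mult_diff_rdistrib)
  have D: "sym_matrix D"
    by (rule sym_matrixI)
       (simp add: Dv inner_diff_left inner_diff_right sym_matrix_inner[OF S(1)] sym_matrix_inner[OF T(1)])
  have STM: "S *v (S *v x) = M *v x" "T *v (T *v x) = M *v x" for x
    by (simp_all add: matrix_vector_mul_assoc S(3) T(3))
  have "(S ** D + D ** T) *v x = 0 *v x" for x
    by (simp add: matrix_vector_mult_add_rdistrib matrix_vector_mul_assoc[symmetric] Dv STM
        matrix_vector_mult_diff_distrib)
  then have "S ** D + D ** T = 0"
    unfolding matrix_eq by blast
  then have "D ** (S ** D) + D ** (D ** T) = 0"
    by (simp flip: matrix_add_ldistrib)
  \<comment> \<open>Cyclicity of the trace turns \<open>D D T\<close> into \<open>D T D\<close>, so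
    both summands become congruences by \<open>D\<close>.\<close>
  then have 0: "trace (D ** S ** D) + trace (D ** T ** D) = 0"
    using trace_mul_sym[of "D ** T" D] trace_add[of "D ** (S ** D)" "D ** (D ** T)"]
      trace_sub[of D D]
    by (simp add: matrix_mul_assoc)
  have tr: "trace (D ** R ** D) = (\<Sum>i\<in>UNIV. (R *v (D *v axis i 1)) \<bullet> (D *v axis i 1))" for R
  proof -
    have "(D ** R ** D) $ i $ i = (R *v (D *v axis i 1)) \<bullet> (D *v axis i 1)" for i
    proof -
      have "(D ** R ** D) $ i $ i = ((D ** R ** D) *v axis i 1) \<bullet> axis i 1"
        by (simp add: inner_axis matrix_vector_mult_basis column_def)
      also have "\<dots> = (D *v (R *v (D *v axis i 1))) \<bullet> axis i 1"
        by (simp add: matrix_vector_mul_assoc matrix_mul_assoc)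
      finally show ?thesis by (simp add: sym_matrix_inner[OF D])
    qed
    then show ?thesis by (simp add: trace_def)
  qed
  have "(S *v (D *v axis i 1)) \<bullet> (D *v axis i 1) = 0" for i
  proof -
    have "trace (D ** S ** D) \<ge> 0" "trace (D ** T ** D) \<ge> 0"
      unfolding tr by (intro sum_nonneg S T)+
    then have "trace (D ** S ** D) = 0" using 0 by linarith
    then show ?thesis
      unfolding tr by (subst (asm) sum_nonneg_eq_0_iff) (auto intro: S)
  qed
  then have "(S *v (D *v axis i 1)) \<bullet> (S *v (D *v axis i 1)) = 0" for i
    by (rule semidefinite_form_isotropic[OF matrix_vector_mul_linear sym_matrix_inner[OF S(1)]
          subspace_UNIV S(2) UNIV_I _ UNIV_I])
  then have "S *v (D *v axis i 1) = 0" for i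
    by simp
  then have "M *v (D *v axis i 1) = 0" for i
    by (simp add: S(3)[symmetric] matrix_vector_mul_assoc[symmetric])
  then have "D *v axis i 1 = 0" for i
    using M by (metis inner_zero_left less_irrefl pos_def_matrix_def)
  then have "D = 0"
    by (simp add: matrix_vector_mult_basis column_def vec_eq_iff)
  then show ?thesis by (simp add: D_def)
qed

lemma matrix_sqrt_props:
  assumes "pos_def_matrix M"
  shows sym_matrix_sqrt: "sym_matrix (matrix_sqrt M)"
    and matrix_sqrt_nonneg: "(matrix_sqrt M *v u) \<bullet> u \<ge> 0"
    and matrix_sqrt_square: "matrix_sqrt M ** matrix_sqrt M = M"
proof -
  let ?P = "\<lambda>S. sym_matrix S \<and> (\<forall>u. (S *v u) \<bullet> u \<ge> 0) \<and> S ** S = M"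
  have "(M *v u) \<bullet> u \<ge> 0" for u
    using assms by (cases "u = 0") (auto simp: pos_def_matrix_def less_imp_le)
  then have "\<exists>!S. ?P S"
    using sqrt_matrix_exists[of M] sqrt_matrix_unique[OF assms] assms
    unfolding pos_def_matrix_def by blast
  then have "?P (matrix_sqrt M)"
    unfolding matrix_sqrt_def by (rule theI')
  then show "sym_matrix (matrix_sqrt M)" "(matrix_sqrt M *v u) \<bullet> u \<ge> 0"
    "matrix_sqrt M ** matrix_sqrt M = M"
    by auto
qed

text \<open>The inverse of the root of \<open>M\<close> is a symmetric nonnegative root of
  \<open>matrix_inv M\<close>, and such a root is unique.\<close>

lemma matrix_sqrt_inv:
  assumes M: "pos_def_matrix M"
  shows "matrix_sqrt (matrix_inv M) ** matrix_sqrt M = mat 1"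
proof -
  define R where "R = matrix_sqrt M"
  have R: "sym_matrix R" "(R *v u) \<bullet> u \<ge> 0" "R ** R = M" for u
    using matrix_sqrt_props[OF M] by (simp_all add: R_def)
  have M1: "matrix_inv M ** M = mat 1"
    using matrix_inv_mult[OF pos_def_matrix_invertible[OF M]] by simp
  then have "(matrix_inv M ** R) ** R = mat 1"
    by (simp add: matrix_mul_assoc[symmetric] R)
  then have "invertible R"
    using invertible_left_inverse by blast
  note Ri = matrix_inv_mult[OF this]
  have RRi: "R *v (matrix_inv R *v x) = x" for x
    by (simp add: matrix_vector_mul_assoc Ri)
  have "matrix_inv R ** matrix_inv R = (matrix_inv M ** M) ** (matrix_inv R ** matrix_inv R)"
    by (simp add: M1)
  also have "\<dots> = matrix_inv M ** (R ** (R ** matrix_inv R) ** matrix_inv R)"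
    by (simp only: R(3)[symmetric] matrix_mul_assoc)
  finally have sq: "matrix_inv R ** matrix_inv R = matrix_inv M"
    by (simp add: Ri)
  have "sym_matrix (matrix_inv R)"
  proof (rule sym_matrixI)
    show "(matrix_inv R *v x) \<bullet> y = x \<bullet> (matrix_inv R *v y)" for x y
      using sym_matrix_inner[OF R(1), of "matrix_inv R *v x" "matrix_inv R *v y"] by (simp add: RRi)
  qed
  moreover have "(matrix_inv R *v u) \<bullet> u \<ge> 0" for u
    using R(2)[of "matrix_inv R *v u"] by (simp add: RRi inner_commute)
  ultimately have "matrix_sqrt (matrix_inv M) = matrix_inv R"
    using sqrt_matrix_unique[OF pos_def_matrix_inv[OF M]] sq
      matrix_sqrt_props[OF pos_def_matrix_inv[OF M]] by blast
  then show ?thesis using Ri by (simp add: R_def)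
qed

text \<open>The condition on \<open>w\<close> says that \<open>M *v w - y\<close> is orthogonal to
  \<open>E\<close>. With \<open>R\<close> the root of \<open>M\<close>, this makes
  \<open>R *v w\<close> the projection of \<open>R^-1 y\<close> onto \<open>R E\<close>, and
  applying \<open>R^-1\<close> recovers \<open>w\<close>. The square-root formula for the initial
  velocity is an instance.\<close>

lemma orth_proj_matrix_sqrt:
  assumes M: "pos_def_matrix M" and E: "subspace E" and w: "w \<in> E"
    and z: "\<And>z. z \<in> E \<Longrightarrow> (M *v w) \<bullet> z = y \<bullet> z"
  shows "matrix_sqrt (matrix_inv M) *v
           orth_proj ((*v) (matrix_sqrt M) ` E) (matrix_sqrt (matrix_inv M) *v y) = w"
proof -
  define R Ri where "R = matrix_sqrt M" and "Ri = matrix_sqrt (matrix_inv M)"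
  have RiR: "Ri *v (R *v x) = x" for x
    using matrix_sqrt_inv[OF M] by (simp add: R_def Ri_def matrix_vector_mul_assoc)
  have symRi: "sym_matrix Ri"
    by (simp add: Ri_def sym_matrix_sqrt pos_def_matrix_inv M)
  have symR: "sym_matrix R" by (simp add: R_def sym_matrix_sqrt M)
  have RR: "R *v (R *v x) = M *v x" for x
    using matrix_sqrt_square[OF M] by (simp add: R_def matrix_vector_mul_assoc)
  have "orth_proj ((*v) R ` E) (Ri *v y) = R *v w"
  proof (rule orth_proj_unique)
    show "subspace ((*v) R ` E)"
      by (intro linear_subspace_image E) simp
    show "R *v w \<in> (*v) R ` E" using w by blast
    fix v assume "v \<in> (*v) R ` E"
    then obtain u where u: "u \<in> E" "v = R *v u" by blast
    have "(Ri *v y) \<bullet> (R *v u) = y \<bullet> u"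
      by (simp add: sym_matrix_inner[OF symRi] RiR)
    moreover have "(R *v w) \<bullet> (R *v u) = (M *v w) \<bullet> u"
      by (simp add: sym_matrix_inner[OF symR, symmetric] RR)
    ultimately show "(Ri *v y - R *v w) \<bullet> v = 0"
      using z[OF u(1)] by (simp add: u inner_diff_left)
  qed
  then show ?thesis by (simp add: R_def[symmetric] Ri_def[symmetric] RiR)
qed

section \<open>Curves\<close>

text \<open>Cramer's rule expresses each coordinate of the solution as a quotient of determinants.
  It yields continuity of velocities that are known only through the Jacobian
  \<open>d\<Phi>\<close>.\<close>

lemma continuous_on_linear_solution:
  fixes M :: "'a::topological_space \<Rightarrow> real^'n^'n"
  assumes M: "continuous_on S M" and inv: "\<And>s. s \<in> S \<Longrightarrow> invertible (M s)"
    and w: "continuous_on S w" and z: "\<And>s. s \<in> S \<Longrightarrow> M s *v z s = w s"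
  shows "continuous_on S z"
proof -
  have entry: "continuous_on S (\<lambda>s. M s $ i $ j)" for i j
    by (intro continuous_intros M)
  have wi: "continuous_on S (\<lambda>s. w s $ i)" for i
    by (intro continuous_intros w)
  have num: "continuous_on S (\<lambda>s. det (\<chi> i j. if j = k then w s $ i else M s $ i $ j))" for k
  proof -
    have "continuous_on S (\<lambda>s. if j = k then w s $ i else M s $ i $ j)" for i j
      by (cases "j = k") (simp_all add: entry wi)
    then show ?thesis
      unfolding det_def by (auto intro!: continuous_intros)
  qed
  have den: "continuous_on S (\<lambda>s. det (M s))"
    unfolding det_def by (intro continuous_intros entry)
  have nz: "det (M s) \<noteq> 0" if "s \<in> S" for s
    using inv[OF that] by (simp add: invertible_det_nz)
  have "continuous_on S (\<lambda>s. \<chi> k. det (\<chi> i j. if j = k then w s $ i else M s $ i $ j) / det (M s))"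
    by (intro continuous_on_vec_lambda continuous_on_divide num den) (use nz in blast)
  moreover have "z s = (\<chi> k. det (\<chi> i j. if j = k then w s $ i else M s $ i $ j) / det (M s))"
    if "s \<in> S" for s
    using cramer[OF nz[OF that], of "z s" "w s"] z[OF that] by simp
  ultimately show ?thesis
    by (simp cong: continuous_on_cong)
qed

lemma maximal_curveD:
  assumes "maximal_curve Q I x" "Q J y" "I \<subseteq> J" "\<And>t. t \<in> I \<Longrightarrow> y t = x t"
  shows "J = I"
  using assms unfolding maximal_curve_def by blast

text \<open>By strict convexity of the Euclidean norm, equality in the triangle inequality at all times
  leaves no choice but the chord.\<close>

lemma distance_affine_imp_chord:
  fixes f :: "real \<Rightarrow> 'a::real_inner"
  assumes dist: "\<And>s r. s \<in> S \<Longrightarrow> r \<in> S \<Longrightarrow> s < r \<Longrightarrow> norm (f r - f s) = k * (r - s)"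
    and "s \<in> S" "m \<in> S" "r \<in> S" "s < m" "m < r"
  shows "f m = f s + ((m - s) / (r - s)) *\<^sub>R (f r - f s)"
proof -
  have d: "norm (f m - f s) = k * (m - s)" "norm (f r - f m) = k * (r - m)"
    "norm (f r - f s) = k * (r - s)"
    using assms by (auto intro!: dist)
  have eq: "(m - s) *\<^sub>R (f r - f m) = (r - m) *\<^sub>R (f m - f s)"
  proof (cases "k = 0")
    case True
    then show ?thesis using d by simp
  next
    case False
    have "norm ((f m - f s) + (f r - f m)) = norm (f m - f s) + norm (f r - f m)"
      using d by (simp add: right_diff_distrib)
    then have "norm (f m - f s) *\<^sub>R (f r - f m) = norm (f r - f m) *\<^sub>R (f m - f s)"
      by (simp only: norm_triangle_eq)
    then have "k *\<^sub>R ((m - s) *\<^sub>R (f r - f m)) = k *\<^sub>R ((r - m) *\<^sub>R (f m - f s))"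
      using d by simp
    then show ?thesis using False by (simp only: scaleR_cancel_left) simp
  qed
  have "(m - s) *\<^sub>R (f r - f s) = (m - s) *\<^sub>R (f r - f m) + (m - s) *\<^sub>R (f m - f s)"
    by (simp add: algebra_simps)
  also have "\<dots> = (r - s) *\<^sub>R (f m - f s)"
    unfolding eq by (simp add: algebra_simps)
  finally have "(1 / (r - s)) *\<^sub>R ((m - s) *\<^sub>R (f r - f s)) = f m - f s"
    using assms by simp
  then show ?thesis by simp
qed

text \<open>Between \<open>s\<close> and \<open>r\<close> the curve coincides with its chord, whose
  slope does not depend on \<open>t\<close>.\<close>

lemma distance_affine_imp_constant_velocity:
  fixes f :: "real \<Rightarrow> 'a::real_inner"
  assumes dist: "\<And>s r. s \<in> S \<Longrightarrow> r \<in> S \<Longrightarrow> s < r \<Longrightarrow> norm (f r - f s) = k * (r - s)"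
    and S: "s \<in> S" "r \<in> S" "{s<..<r} \<subseteq> S" and t: "s < t" "t < r"
    and f: "(f has_vector_derivative D) (at t)"
  shows "D = (1 / (r - s)) *\<^sub>R (f r - f s)"
proof -
  let ?g = "\<lambda>m. f s + ((m - s) / (r - s)) *\<^sub>R (f r - f s)"
  have "(?g has_vector_derivative (1 / (r - s)) *\<^sub>R (f r - f s)) (at t)"
    using t by (auto intro!: derivative_eq_intros)
  then have "(f has_vector_derivative (1 / (r - s)) *\<^sub>R (f r - f s)) (at t)"
  proof (rule has_vector_derivative_transform_within_open[of _ _ _ "{s<..<r}"])
    show "?g m = f m" if "m \<in> {s<..<r}" for m
      using distance_affine_imp_chord[OF dist S(1) _ S(2), of m] that S(3) by auto
  qed (use t in auto)
  then show ?thesis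
    using f vector_derivative_unique_at by blast
qed

section \<open>Legendre transform coordinates\<close>

lemma gradient_eqI: "GDERIV f x :> D \<Longrightarrow> gradient f x = D"
proof -
  assume D: "GDERIV f x :> D"
  have "E = D" if "GDERIV f x :> E" for E
  proof -
    have "(\<lambda>u. u \<bullet> E) = (\<lambda>u. u \<bullet> D)"
      using has_derivative_unique that D unfolding gderiv_def by blast
    then show ?thesis by (metis vector_eq_ldot)
  qed
  with D show ?thesis unfolding gradient_def by (intro the_equality)
qed

lemma gradient_inner: "gradient (\<lambda>y. c \<bullet> y) x = c"
  by (rule gradient_eqI)
     (auto simp: gderiv_def inner_commute intro!: derivative_eq_intros)

lemma subspace_ker: "subspace (ker A)"
  by (auto simp: ker_def subspace_def matrix_vector_right_distrib matrix_vector_mult_scaleR)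

locale legendre_setting =
  fixes A :: "real^'n^'m" and b :: "real^'m" and C :: "(real^'n) set" and h :: "real^'n \<Rightarrow> ereal"
  assumes rank: "rank A = CARD('m)" and open_C: "open C" and convex_C: "convex C"
    and C2: "C2_on C (fin_part h)" and pos_def: "\<And>y. y \<in> C \<Longrightarrow> pos_def_matrix (Hess h y)"
begin

abbreviation F :: "(real^'n) set" where "F \<equiv> feasible A b C"
abbreviation P :: "real^'n \<Rightarrow> real^'n" where "P \<equiv> orth_proj (ker A)"
abbreviation \<phi> :: "real^'n \<Rightarrow> real^'n" where "\<phi> \<equiv> legendre_coord A h"

text \<open>Legendre coordinates along \<open>ker A\<close>, completed by the affine coordinates along its orthogonal
  complement, which are constant on the feasible set. This turns \<open>legendre_coord\<close> into a
  diffeomorphism between open subsets of the whole space.\<close>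

definition \<Phi> :: "real^'n \<Rightarrow> real^'n" where
  "\<Phi> y = \<phi> y + (y - P y)"

definition d\<Phi> :: "real^'n \<Rightarrow> real^'n^'n" where
  "d\<Phi> y = matrix P ** Hess h y + (mat 1 - matrix P)"

lemma linear_P: "linear P"
  by (rule linear_orth_proj[OF subspace_ker])

lemma P_in: "P y \<in> ker A"
  by (rule orth_proj_in[OF subspace_ker])

lemma P_self: "y \<in> ker A \<Longrightarrow> P y = y"
  by (rule orth_proj_self[OF subspace_ker])

lemma P_P: "P (P y) = P y"
  by (simp add: P_self P_in)

lemma P_inner: "w \<in> ker A \<Longrightarrow> P y \<bullet> w = y \<bullet> w"
  by (rule orth_proj_inner[OF subspace_ker])

lemma bounded_linear_P: "bounded_linear P"
  using linear_P linear_conv_bounded_linear by blast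

lemma matrix_P: "matrix P *v u = P u"
  using linear_P by (intro matrix_works) (simp add: linear_matrix_vector_mul_eq)

lemma d\<Phi>_mult: "d\<Phi> y *v u = P (Hess h y *v u) + (u - P u)"
  by (simp add: d\<Phi>_def matrix_vector_mult_add_rdistrib matrix_vector_mult_diff_rdistrib
      matrix_vector_mul_assoc[symmetric] matrix_P)

lemma P_d\<Phi>: "P (d\<Phi> y *v u) = P (Hess h y *v u)"
  by (simp add: d\<Phi>_mult linear_add[OF linear_P] linear_diff[OF linear_P] P_P)

lemma d\<Phi>_tangent: "u \<in> ker A \<Longrightarrow> d\<Phi> y *v u = P (Hess h y *v u)"
  by (simp add: d\<Phi>_mult P_self)

lemma P_\<Phi>: "P (\<Phi> y) = \<phi> y"
  by (simp add: \<Phi>_def legendre_coord_def linear_add[OF linear_P] linear_diff[OF linear_P] P_P)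

lemma \<Phi>_normal: "\<Phi> y - P (\<Phi> y) = y - P y"
  unfolding P_\<Phi> by (simp add: \<Phi>_def)

text \<open>Pairing with the tangent vector \<open>u\<close> itself removes the projection and
  leaves the positive definite form of the Hessian. So the differential of \<open>\<phi>\<close> is
  injective on the tangent space.\<close>

lemma P_hess_inj:
  assumes "y \<in> C" "u \<in> ker A" "P (Hess h y *v u) = 0"
  shows "u = 0"
proof (rule ccontr)
  assume "u \<noteq> 0"
  then have "(Hess h y *v u) \<bullet> u > 0"
    using pos_def[OF assms(1)] by (simp add: pos_def_matrix_def)
  then show False
    using P_inner[OF assms(2), of "Hess h y *v u"] assms(3) by simp
qed

text \<open>For a kernel vector the two orthogonal components vanish separately: the normal one puts
  it in \<open>ker A\<close>, and the tangential one is then covered by injectivity on tangent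
  vectors.\<close>

lemma invertible_d\<Phi>:
  assumes "y \<in> C"
  shows "invertible (d\<Phi> y)"
proof -
  have "u = 0" if u: "d\<Phi> y *v u = 0" for u
  proof -
    have 0: "P (Hess h y *v u) = 0"
      using P_d\<Phi>[of y u] u by (simp add: linear_0[OF linear_P])
    then have "u = P u" using u by (simp add: d\<Phi>_mult)
    then show ?thesis using P_hess_inj[OF assms _ 0] P_in by metis
  qed
  then show ?thesis
    by (simp add: invertible_left_inverse matrix_left_invertible_ker)
qed

lemma gradient_has_derivative:
  assumes "y \<in> C"
  shows "(gradient (fin_part h) has_derivative (*v) (Hess h y)) (at y)"
proof -
  have d: "gradient (fin_part h) differentiable (at y)"
    using C2 assms by (simp add: C2_on_def)
  then have D: "(gradient (fin_part h) has_derivative frechet_derivative (gradient (fin_part h)) (at y)) (at y)"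
    by (simp add: frechet_derivative_works)
  have "(*v) (Hess h y) = frechet_derivative (gradient (fin_part h)) (at y)"
    unfolding hessian_def
    using has_derivative_linear[OF D] by (intro ext matrix_works) (simp add: linear_matrix_vector_mul_eq)
  then show ?thesis using D by simp
qed

lemma \<phi>_has_derivative:
  assumes "y \<in> C"
  shows "(\<phi> has_derivative (\<lambda>u. P (Hess h y *v u))) (at y)"
  using bounded_linear.has_derivative[OF bounded_linear_P gradient_has_derivative[OF assms]]
  by (simp add: legendre_coord_def[abs_def])

lemma d_legendre_coord_eq: "y \<in> C \<Longrightarrow> d_legendre_coord A h y = (\<lambda>u. P (Hess h y *v u))"
  unfolding d_legendre_coord_def by (rule frechet_derivative_at[OF \<phi>_has_derivative, symmetric])

lemma \<Phi>_has_derivative: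
  assumes "y \<in> C"
  shows "(\<Phi> has_derivative (*v) (d\<Phi> y)) (at y)"
proof -
  have "(\<Phi> has_derivative (\<lambda>u. P (Hess h y *v u) + (u - P u))) (at y)"
    unfolding \<Phi>_def[abs_def]
    by (intro has_derivative_add has_derivative_diff has_derivative_ident \<phi>_has_derivative assms
        bounded_linear.has_derivative[OF bounded_linear_P])
  moreover have "(*v) (d\<Phi> y) = (\<lambda>u. P (Hess h y *v u) + (u - P u))"
    by (rule ext) (rule d\<Phi>_mult)
  ultimately show ?thesis by simp
qed

section \<open>Global injectivity of the coordinates and the inverse map\<close>

lemma continuous_on_\<Phi>: "continuous_on C \<Phi>"
  by (rule has_derivative_continuous_on, rule has_derivative_at_withinI, rule \<Phi>_has_derivative)

lemma continuous_on_hess: "continuous_on C (Hess h)"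
  using C2 by (simp add: C2_on_def)

lemma continuous_on_d\<Phi>: "continuous_on C d\<Phi>"
  unfolding d\<Phi>_def[abs_def] matrix_matrix_mult_def
  by (intro continuous_intros continuous_on_hess)

text \<open>Points with equal images have equal normal parts, so they differ by some
  \<open>d\<close> in \<open>ker A\<close>. Along the segment between them, which stays in the
  convex set \<open>C\<close>, the inner product of the gradient with \<open>d\<close> strictly
  increases, while equality of \<open>\<phi>\<close> makes its end values agree.\<close>

lemma inj_on_\<Phi>: "inj_on \<Phi> C"
proof (rule inj_onI, rule ccontr)
  fix x y assume x: "x \<in> C" and y: "y \<in> C" and eq: "\<Phi> x = \<Phi> y" and ne: "x \<noteq> y"
  define d where "d = x - y"
  have \<phi>: "\<phi> x = \<phi> y" using eq P_\<Phi> by metis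
  then have "x - P x = y - P y" using eq by (simp add: \<Phi>_def)
  then have "d = P x - P y" by (simp add: d_def algebra_simps)
  then have d: "d \<in> ker A" using P_in subspace_ker subspace_diff by metis
  define g where "g t = gradient (fin_part h) (y + t *\<^sub>R d) \<bullet> d" for t
  have deriv: "DERIV g t :> (Hess h (y + t *\<^sub>R d) *v d) \<bullet> d" and
    pos: "(Hess h (y + t *\<^sub>R d) *v d) \<bullet> d > 0" if t: "0 \<le> t" "t \<le> 1" for t
  proof -
    have "y + t *\<^sub>R d = (1 - t) *\<^sub>R y + t *\<^sub>R x" by (simp add: d_def algebra_simps)
    then have C: "y + t *\<^sub>R d \<in> C"
      using convexD_alt[OF convex_C y x t] by simp
    show "(Hess h (y + t *\<^sub>R d) *v d) \<bullet> d > 0"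
      using pos_def[OF C] ne by (simp add: pos_def_matrix_def d_def)
    have "((\<lambda>t. y + t *\<^sub>R d) has_derivative (\<lambda>s. s *\<^sub>R d)) (at t)"
      by (auto intro!: derivative_eq_intros)
    from has_derivative_compose[OF this gradient_has_derivative[OF C]]
    have "((\<lambda>t. gradient (fin_part h) (y + t *\<^sub>R d)) has_derivative
        (\<lambda>s. Hess h (y + t *\<^sub>R d) *v (s *\<^sub>R d))) (at t)" .
    from has_derivative_inner_left[OF this, of d]
    show "DERIV g t :> (Hess h (y + t *\<^sub>R d) *v d) \<bullet> d"
      by (simp add: g_def[abs_def] has_field_derivative_def matrix_vector_mult_scaleR
          mult.commute[of _ "_ \<bullet> _"] mult_commute_abs)
  qed
  have "g 0 < g 1"
    by (rule DERIV_pos_imp_increasing[of 0 1 g]) (use deriv pos in auto)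
  moreover have "y + d = x" by (simp add: d_def)
  then have "g 1 = \<phi> x \<bullet> d" "g 0 = \<phi> y \<bullet> d"
    by (simp_all add: g_def legendre_coord_def P_inner[OF d])
  ultimately show False using \<phi> by simp
qed

text \<open>Invariance of domain. Openness leaves room to pull short straight segments back from the
  coordinates.\<close>

lemma open_\<Phi>_image: "open (\<Phi> ` C)"
  by (rule invariance_of_domain[OF continuous_on_\<Phi> open_C inj_on_\<Phi>])

lemma \<Phi>_inverse_has_derivative:
  assumes "y \<in> C"
  shows "(inv_into C \<Phi> has_derivative (*v) (matrix_inv (d\<Phi> y))) (at (\<Phi> y))"
proof (rule has_derivative_inverse_strong[OF open_C assms continuous_on_\<Phi>])
  show "inv_into C \<Phi> (\<Phi> x) = x" if "x \<in> C" for x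
    using inj_on_\<Phi> that by simp
  show "(\<Phi> has_derivative (*v) (d\<Phi> y)) (at y)" by (rule \<Phi>_has_derivative[OF assms])
  show "(*v) (d\<Phi> y) \<circ> (*v) (matrix_inv (d\<Phi> y)) = id"
    using matrix_inv_mult[OF invertible_d\<Phi>[OF assms]]
    by (auto simp: fun_eq_iff matrix_vector_mul_assoc)
qed

section \<open>The feasible set in coordinates\<close>

lemma feasible_in_C: "y \<in> F \<Longrightarrow> y \<in> C"
  by (simp add: feasible_def)

lemma feasible_diff: "y \<in> F \<Longrightarrow> z \<in> F \<Longrightarrow> y - z \<in> ker A"
  by (simp add: feasible_def ker_def matrix_vector_mult_diff_distrib)

text \<open>The linear constraint fixes exactly the component orthogonal to \<open>ker A\<close>, so
  within \<open>C\<close> the feasible set is one fibre of that component.\<close>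

lemma feasible_iff_normal:
  assumes "y \<in> F" "z \<in> C"
  shows "z \<in> F \<longleftrightarrow> z - P z = y - P y"
proof
  assume "z \<in> F"
  then have "P (z - y) = z - y" using assms feasible_diff P_self by blast
  then show "z - P z = y - P y" by (simp add: linear_diff[OF linear_P] algebra_simps)
next
  assume "z - P z = y - P y"
  then have "z - y = P (z - y)" by (simp add: linear_diff[OF linear_P] algebra_simps)
  then have "z - y \<in> ker A" using P_in by metis
  then show "z \<in> F"
    using assms by (simp add: feasible_def ker_def matrix_vector_mult_diff_distrib)
qed

text \<open>The normal component is constant on the feasible set, so there \<open>\<Phi>\<close> is
  \<open>\<phi>\<close> up to a translation. Injectivity and chords thus pass between the two
  maps.\<close>

lemma \<Phi>_diff_feasible:
  assumes "y \<in> F" "z \<in> F"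
  shows "\<Phi> y - \<Phi> z = \<phi> y - \<phi> z"
  using feasible_iff_normal[OF assms(2) feasible_in_C[OF assms(1)]] assms
  by (simp add: \<Phi>_def)

lemma feasible_curve_tangent:
  assumes "open J" "t \<in> J" "\<And>s. s \<in> J \<Longrightarrow> y s \<in> F" and D: "(y has_vector_derivative D) (at t)"
  shows "D \<in> ker A"
proof -
  have "((\<lambda>s. A *v y s) has_vector_derivative A *v D) (at t)"
    by (rule bounded_linear.has_vector_derivative[OF matrix_vector_mul_bounded_linear D])
  moreover have "((\<lambda>s. b) has_vector_derivative 0) (at t)" by simp
  then have "((\<lambda>s. A *v y s) has_vector_derivative 0) (at t)"
    by (rule has_vector_derivative_transform_within_open[OF _ assms(1,2)])
       (use assms(3) in \<open>auto simp: feasible_def\<close>)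
  ultimately have "A *v D = 0" by (rule vector_derivative_unique_at)
  then show ?thesis by (simp add: ker_def)
qed

lemma legendre_curve_has_vector_derivative:
  assumes "y t \<in> C" and D: "(y has_vector_derivative D) (at t within S)"
  shows "((\<lambda>s. \<phi> (y s)) has_vector_derivative P (Hess h (y t) *v D)) (at t within S)"
proof -
  from has_derivative_compose[OF D[unfolded has_vector_derivative_def] \<phi>_has_derivative[OF assms(1)]]
  show ?thesis
    by (simp add: has_vector_derivative_def matrix_vector_mult_scaleR linear_scale[OF linear_P])
qed

section \<open>Lengths of curves\<close>

abbreviation g where "g \<equiv> H2_metric A h"

text \<open>For \<open>y t\<close> in \<open>C\<close>, the right-hand side is the Euclidean speed
  of the image of \<open>y\<close> under \<open>\<phi>\<close>: this is the isometry behind all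
  length computations.\<close>

lemma curve_speed_eq:
  assumes "(y has_vector_derivative D) (at t)"
  shows "curve_speed g y t = norm (P (Hess h (y t) *v D))"
  using vector_derivative_at[OF assms]
  by (simp add: curve_speed_def H2_metric_def norm_eq_sqrt_inner)

lemma curve_length_constant_speed:
  assumes "s \<le> r" "\<And>t. t \<in> {s..r} \<Longrightarrow> curve_speed g y t = k"
  shows "curve_length g s r y = k * (r - s)"
proof -
  have "curve_length g s r y = integral {s..r} (\<lambda>t. k)"
    unfolding curve_length_def by (rule integral_cong) (use assms in auto)
  then show ?thesis using assms(1) by simp
qed

text \<open>By the isometry the length is the Euclidean length of the image under
  \<open>\<phi>\<close>. The norm of the integrated velocity is at most the integral of its
  norm.\<close>

lemma curve_length_ge_chord:
  assumes "s \<le> r" "p C1_differentiable_on {s..r}" "p ` {s..r} \<subseteq> C"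
  shows "norm (\<phi> (p r) - \<phi> (p s)) \<le> curve_length g s r p"
proof -
  obtain D where D: "\<And>t. t \<in> {s..r} \<Longrightarrow> (p has_vector_derivative D t) (at t)"
    and contD: "continuous_on {s..r} D"
    using assms(2) unfolding C1_differentiable_on_def by blast
  define E where "E t = P (Hess h (p t) *v D t)" for t
  have contp: "continuous_on {s..r} p"
    using assms(2) by (rule C1_differentiable_imp_continuous_on)
  have "continuous_on {s..r} (\<lambda>t. Hess h (p t))"
    using continuous_on_compose2[OF continuous_on_hess contp assms(3)] .
  then have "continuous_on {s..r} (\<lambda>t. Hess h (p t) *v D t)"
    using contD unfolding matrix_vector_mult_def by (intro continuous_intros)
  then have contE: "continuous_on {s..r} E"
    unfolding E_def by (rule bounded_linear.continuous_on[OF bounded_linear_P])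
  have "(E has_integral \<phi> (p r) - \<phi> (p s)) {s..r}"
    unfolding E_def using assms(1)
  proof (rule fundamental_theorem_of_calculus)
    fix t assume t: "t \<in> {s..r}"
    show "((\<lambda>t. \<phi> (p t)) has_vector_derivative P (Hess h (p t) *v D t)) (at t within {s..r})"
      using assms(3) t has_vector_derivative_at_within[OF D[OF t]]
      by (intro legendre_curve_has_vector_derivative) auto
  qed
  then have "\<phi> (p r) - \<phi> (p s) = integral {s..r} E"
    by (simp add: integral_unique)
  also have "norm \<dots> \<le> integral {s..r} (\<lambda>t. norm (E t))"
    by (intro Henstock_Kurzweil_Integration.integral_norm_bound_integral integrable_continuous_real
        contE continuous_on_norm) simp
  also have "\<dots> = curve_length g s r p"
    unfolding curve_length_def E_def
    by (rule integral_cong) (simp add: curve_speed_eq[OF D])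
  finally show ?thesis .
qed

text \<open>Traverse the segment in the coordinates \<open>\<Phi>\<close> at constant velocity and
  pull it back. Its direction lies in \<open>ker A\<close>, so the normal component stays fixed and
  the curve remains feasible. Such curves are the competitors against which a geodesic is
  tested.\<close>

lemma segment_curve:
  assumes sr: "s < r" and y: "y \<in> F" and z: "z \<in> F"
    and seg: "closed_segment (\<Phi> y) (\<Phi> z) \<subseteq> \<Phi> ` C"
  obtains p where "p C1_differentiable_on {s..r}" "p ` {s..r} \<subseteq> F" "p s = y" "p r = z"
    "curve_length g s r p = norm (\<phi> z - \<phi> y)"
proof -
  define W where "W = (1 / (r - s)) *\<^sub>R (\<Phi> z - \<Phi> y)"
  define l where "l t = \<Phi> y + (t - s) *\<^sub>R W" for t
  define p where "p t = inv_into C \<Phi> (l t)" for t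
  define D where "D t = matrix_inv (d\<Phi> (p t)) *v W" for t
  have PW: "P W = W"
  proof (rule P_self)
    have "W = (1 / (r - s)) *\<^sub>R (P (\<Phi> z) - P (\<Phi> y))"
      using \<Phi>_diff_feasible[OF z y] by (simp add: W_def P_\<Phi>)
    then show "W \<in> ker A"
      by (simp only: subspace_scale[OF subspace_ker subspace_diff[OF subspace_ker P_in P_in]])
  qed
  have lC: "l t \<in> \<Phi> ` C" if "t \<in> {s..r}" for t
  proof -
    have "l t = (1 - (t - s) / (r - s)) *\<^sub>R \<Phi> y + ((t - s) / (r - s)) *\<^sub>R \<Phi> z"
      by (simp add: l_def W_def algebra_simps)
    moreover have "0 \<le> (t - s) / (r - s)" "(t - s) / (r - s) \<le> 1"
      using that sr by (auto simp: field_simps)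
    ultimately have "l t \<in> closed_segment (\<Phi> y) (\<Phi> z)"
      unfolding in_segment by blast
    then show ?thesis using seg by blast
  qed
  have pC: "p t \<in> C" and \<Phi>p: "\<Phi> (p t) = l t" if "t \<in> {s..r}" for t
    using lC[OF that] by (auto simp: p_def inv_into_into f_inv_into_f)
  have pF: "p t \<in> F" if "t \<in> {s..r}" for t
  proof -
    have "p t - P (p t) = l t - P (l t)"
      using \<Phi>_normal[of "p t"] \<Phi>p[OF that] by simp
    also have "\<dots> = \<Phi> y - P (\<Phi> y)"
      by (simp add: l_def linear_add[OF linear_P] linear_scale[OF linear_P] PW)
    also have "\<dots> = y - P y" by (rule \<Phi>_normal)
    finally show ?thesis using feasible_iff_normal[OF y pC[OF that]] by simp
  qed
  have der: "(p has_vector_derivative D t) (at t)" if "t \<in> {s..r}" for t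
  proof -
    have "(l has_derivative (\<lambda>u. u *\<^sub>R W)) (at t)"
      unfolding l_def[abs_def] by (auto intro!: derivative_eq_intros)
    moreover have "(inv_into C \<Phi> has_derivative (*v) (matrix_inv (d\<Phi> (p t)))) (at (l t))"
      using \<Phi>_inverse_has_derivative[OF pC[OF that]] \<Phi>p[OF that] by simp
    ultimately have "((\<lambda>t. inv_into C \<Phi> (l t)) has_derivative
        (\<lambda>u. matrix_inv (d\<Phi> (p t)) *v (u *\<^sub>R W))) (at t)"
      by (rule has_derivative_compose)
    then show ?thesis
      by (simp add: has_vector_derivative_def p_def[abs_def] D_def matrix_vector_mult_scaleR)
  qed
  have d\<Phi>D: "d\<Phi> (p t) *v D t = W" if "t \<in> {s..r}" for t
    using matrix_inv_mult[OF invertible_d\<Phi>[OF pC[OF that]]]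
    by (simp add: D_def matrix_vector_mul_assoc)
  have contp: "continuous_on {s..r} p"
    by (rule continuous_at_imp_continuous_on)
       (use der has_vector_derivative_continuous in blast)
  \<comment> \<open>The velocity solves \<open>d\<Phi> (p t) *v D t = W\<close>, a linear system
    with continuous coefficients.\<close>
  have "continuous_on {s..r} D"
  proof (rule continuous_on_linear_solution)
    show "continuous_on {s..r} (\<lambda>t. d\<Phi> (p t))"
      by (rule continuous_on_compose2[OF continuous_on_d\<Phi> contp]) (use pC in auto)
    show "d\<Phi> (p t) *v D t = (\<lambda>_. W) t" if "t \<in> {s..r}" for t
      using d\<Phi>D[OF that] .
  qed (auto intro!: invertible_d\<Phi> pC)
  then have C1: "p C1_differentiable_on {s..r}"
    unfolding C1_differentiable_on_def using der by blast
  have "curve_speed g p t = norm W" if "t \<in> {s..r}" for t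
    using P_d\<Phi>[of "p t" "D t"] by (simp add: curve_speed_eq[OF der[OF that]] d\<Phi>D[OF that] PW)
  then have "curve_length g s r p = norm W * (r - s)"
    using sr by (intro curve_length_constant_speed) auto
  also have "\<dots> = norm (\<phi> z - \<phi> y)"
    using sr \<Phi>_diff_feasible[OF z y] by (simp add: W_def)
  finally have len: "curve_length g s r p = norm (\<phi> z - \<phi> y)" .
  have "p s = y" "p r = z"
    using sr inj_on_\<Phi> feasible_in_C[OF y] feasible_in_C[OF z] by (simp_all add: p_def l_def W_def)
  then show thesis
    using that C1 pF len by blast
qed

section \<open>Steepest descent and geodesics\<close>

lemma transpose_orthogonal_ker:
  assumes "w \<in> ker A"
  shows "(transpose A *v z) \<bullet> w = 0"
proof -
  have "(transpose A *v z) \<bullet> w = z \<bullet> (A *v w)"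
    by (metis dot_lmul_matrix vector_transpose_matrix transpose_transpose)
  then show ?thesis using assms by (simp add: ker_def)
qed

text \<open>For \<open>z\<close> in the kernel and \<open>u = transpose A *v z\<close>, the vector
  \<open>H^-1 u\<close> lies in \<open>ker A\<close>, which is orthogonal to the range of the
  transpose. So the form of the inverse Hessian vanishes at \<open>u\<close>, and
  \<open>u = 0\<close>; surjectivity of \<open>A\<close> then gives \<open>z = 0\<close>.\<close>

lemma invertible_schur:
  assumes "y \<in> C"
  shows "invertible (A ** matrix_inv (Hess h y) ** transpose A)"
proof -
  have "z = 0" if z: "(A ** matrix_inv (Hess h y) ** transpose A) *v z = 0" for z
  proof -
    let ?u = "transpose A *v z"
    have "matrix_inv (Hess h y) *v ?u \<in> ker A"
      using z by (simp add: ker_def matrix_vector_mul_assoc[symmetric] del: transpose_matrix_vector)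
    then have "(matrix_inv (Hess h y) *v ?u) \<bullet> ?u = 0"
      using transpose_orthogonal_ker inner_commute by metis
    then have u: "?u = 0"
      using pos_def_matrix_inv[OF pos_def[OF assms]] by (metis less_irrefl pos_def_matrix_def)
    have "surj ((*v) A)" using rank full_rank_surjective by blast
    then obtain x where x: "z = A *v x" by (meson surjD)
    have "z \<bullet> z = ?u \<bullet> x"
      unfolding x by (metis dot_lmul_matrix vector_transpose_matrix transpose_transpose)
    then show ?thesis using u by simp
  qed
  then show ?thesis
    by (simp add: invertible_left_inverse matrix_left_invertible_ker)
qed

text \<open>The formula has the form \<open>H^-1 (grad f - A^T z)\<close>, where the multiplier
  \<open>z\<close> is chosen so that \<open>A\<close> annihilates the result. Applying
  \<open>H\<close> leaves \<open>grad f\<close> minus a term in the range of the transpose, which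
  the projection removes.\<close>

lemma riem_grad_tangent:
  assumes y: "y \<in> C"
  shows "riem_grad A (Hess h) f y \<in> ker A"
    and "P (Hess h y *v riem_grad A (Hess h) f y) = P (gradient f y)"
proof -
  define Hi where "Hi = matrix_inv (Hess h y)"
  define N where "N = A ** Hi ** transpose A"
  define c where "c = gradient f y"
  define z where "z = matrix_inv N *v (A *v (Hi *v c))"
  have grad: "riem_grad A (Hess h) f y = Hi *v (c - transpose A *v z)"
    by (simp add: riem_grad_def Let_def Hi_def[symmetric] N_def[symmetric] c_def[symmetric] z_def
        matrix_vector_mult_diff_rdistrib matrix_vector_mul_assoc matrix_mul_assoc)
  have "N ** matrix_inv N = mat 1"
    using matrix_inv_mult[OF invertible_schur[OF y]] by (simp add: N_def Hi_def)
  then have "N *v z = A *v (Hi *v c)"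
    unfolding z_def by (subst matrix_vector_mul_assoc) simp
  moreover have "N *v z = A *v (Hi *v (transpose A *v z))"
    by (simp add: N_def matrix_vector_mul_assoc[symmetric] del: transpose_matrix_vector)
  ultimately show "riem_grad A (Hess h) f y \<in> ker A"
    by (simp add: grad ker_def matrix_vector_mult_diff_distrib)
  have "Hess h y *v (Hi *v x) = x" for x
    using matrix_inv_mult[OF pos_def_matrix_invertible[OF pos_def[OF y]]]
    by (simp add: Hi_def matrix_vector_mul_assoc)
  moreover have "P (transpose A *v z) = 0"
    by (rule orth_proj_eq_0[OF subspace_ker transpose_orthogonal_ker])
  ultimately show "P (Hess h y *v riem_grad A (Hess h) f y) = P (gradient f y)"
    by (simp add: grad c_def linear_diff[OF linear_P])
qed

text \<open>Injectivity of the differential of \<open>\<phi>\<close> on \<open>ker A\<close> makes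
  the two properties of the Riemannian gradient a characterization.\<close>

lemma tangent_eq_riem_grad:
  assumes y: "y \<in> C" and u: "u \<in> ker A" and eq: "P (Hess h y *v u) = - P (gradient f y)"
  shows "u = - riem_grad A (Hess h) f y"
proof -
  let ?w = "riem_grad A (Hess h) f y"
  have "P (Hess h y *v (u + ?w)) = 0"
    using riem_grad_tangent(2)[OF y, of f] eq
    by (simp add: matrix_vector_right_distrib linear_add[OF linear_P])
  then have "u + ?w = 0"
    using P_hess_inj[OF y] u riem_grad_tangent(1)[OF y] subspace_ker subspace_add by metis
  then show ?thesis by (simp add: eq_neg_iff_add_eq_0)
qed

section \<open>Steepest descent solutions in Legendre coordinates\<close>

abbreviation HSD where "HSD c \<equiv> HSD_solution A b C h (\<lambda>y. c \<bullet> y)"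

lemma HSD_velocity:
  assumes "HSD c x0 J y" "t \<in> J"
  obtains D where "(y has_vector_derivative D) (at t)" "D \<in> ker A" "y t \<in> F"
    "P (Hess h (y t) *v D) = - P c"
proof
  let ?D = "- riem_grad A (Hess h) (\<lambda>y. c \<bullet> y) (y t)"
  show F: "y t \<in> F" and "(y has_vector_derivative ?D) (at t)"
    using assms by (auto simp: HSD_solution_def)
  show "?D \<in> ker A" "P (Hess h (y t) *v ?D) = - P c"
    using riem_grad_tangent[OF feasible_in_C[OF F], of "\<lambda>y. c \<bullet> y"]
    by (simp_all add: subspace_neg[OF subspace_ker] linear_neg[OF linear_P] gradient_inner
        linear_neg[OF matrix_vector_mul_linear])
qed

text \<open>The image of a solution under \<open>\<phi>\<close> has velocity \<open>- P c\<close>,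
  so adding \<open>t *\<^sub>R P c\<close> gives a function with zero derivative on the interval
  \<open>J\<close>.\<close>

lemma HSD_legendre:
  assumes sol: "HSD c x0 J y" and t: "s \<in> J" "t \<in> J"
  shows "\<phi> (y t) - \<phi> (y s) = (s - t) *\<^sub>R P c"
proof -
  let ?f = "\<lambda>t. \<phi> (y t) + t *\<^sub>R P c"
  have J: "convex J" using sol by (simp add: HSD_solution_def is_interval_convex)
  have "(?f has_vector_derivative 0) (at r within J)" if r: "r \<in> J" for r
  proof -
    obtain D where D: "(y has_vector_derivative D) (at r)" "y r \<in> F" "P (Hess h (y r) *v D) = - P c"
      using HSD_velocity[OF sol r] by blast
    have "(?f has_vector_derivative (P (Hess h (y r) *v D) + P c)) (at r)"
      by (intro has_vector_derivative_add legendre_curve_has_vector_derivative D(1)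
          feasible_in_C D(2)) (auto intro!: derivative_eq_intros)
    then show ?thesis using D(3) by (simp add: has_vector_derivative_at_within)
  qed
  from has_vector_derivative_zero_constant[OF J this] obtain a where "\<And>r. r \<in> J \<Longrightarrow> ?f r = a"
    by blast
  then have "\<phi> (y t) + t *\<^sub>R P c = \<phi> (y s) + s *\<^sub>R P c" using t by metis
  then show ?thesis by (simp add: algebra_simps)
qed

text \<open>Both images under \<open>\<phi>\<close> leave the same point with the same constant
  velocity, and \<open>\<Phi>\<close> is injective.\<close>

lemma HSD_solutions_agree:
  assumes "HSD c x0 I x" "HSD c x0 J y" "t \<in> I" "t \<in> J"
  shows "x t = y t"
proof -
  have "0 \<in> I" "0 \<in> J" "x 0 = y 0"
    using assms by (auto simp: HSD_solution_def)
  then have "\<phi> (x t) - \<phi> (x 0) = \<phi> (y t) - \<phi> (x 0)"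
    using HSD_legendre[OF assms(1) _ assms(3), of 0] HSD_legendre[OF assms(2) _ assms(4), of 0]
    by simp
  then have "\<phi> (x t) = \<phi> (y t)" by simp
  moreover have "x t \<in> F" "y t \<in> F"
    using assms by (auto simp: HSD_solution_def)
  ultimately have "\<Phi> (x t) = \<Phi> (y t)"
    using \<Phi>_diff_feasible[of "x t" "y t"] by simp
  then show ?thesis
    using inj_on_\<Phi> feasible_in_C \<open>x t \<in> F\<close> \<open>y t \<in> F\<close> by (auto dest: inj_onD)
qed

text \<open>Since the solutions agree on the overlap, the pasted curve equals one of them on an open
  set around each time, and the equation carries over. Both intervals contain \<open>0\<close>, so
  their union is an interval.\<close>

lemma HSD_union:
  assumes x: "HSD c x0 I x" and y: "HSD c x0 J y"
  shows "HSD c x0 (I \<union> J) (\<lambda>t. if t \<in> I then x t else y t)"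
proof -
  have I: "open I" "is_interval I" "0 \<in> I" and J: "open J" "is_interval J" "0 \<in> J"
    using x y by (auto simp: HSD_solution_def)
  define z where "z t = (if t \<in> I then x t else y t)" for t
  have zx: "z t = x t" if "t \<in> I" for t using that by (simp add: z_def)
  have zy: "z t = y t" if "t \<in> J" for t using HSD_solutions_agree[OF x y] that by (simp add: z_def)
  have interval: "is_interval (I \<union> J)"
    using I J connected_Un[of I J] by (auto simp: is_interval_connected_1)
  have extend: "z t \<in> F \<and> (z has_vector_derivative - riem_grad A (Hess h) (\<lambda>y. c \<bullet> y) (z t)) (at t)"
    if t: "t \<in> K" and K: "open K" "\<And>t. t \<in> K \<Longrightarrow> z t = w t" and w: "HSD c x0 K w" for t K w
  proof -
    have F: "w t \<in> F" and
      der: "(w has_vector_derivative - riem_grad A (Hess h) (\<lambda>y. c \<bullet> y) (w t)) (at t)"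
      using w t by (auto simp: HSD_solution_def)
    have "(z has_vector_derivative - riem_grad A (Hess h) (\<lambda>y. c \<bullet> y) (w t)) (at t)"
      by (rule has_vector_derivative_transform_within_open[OF der K(1) t]) (simp add: K(2))
    then show ?thesis using F by (simp add: K(2)[OF t])
  qed
  have "z t \<in> F \<and> (z has_vector_derivative - riem_grad A (Hess h) (\<lambda>y. c \<bullet> y) (z t)) (at t)"
    if "t \<in> I \<union> J" for t
    using that extend[OF _ I(1) zx x] extend[OF _ J(1) zy y] by blast
  moreover have "z 0 = x0"
    using x I by (simp add: z_def HSD_solution_def)
  ultimately have "HSD c x0 (I \<union> J) z"
    unfolding HSD_solution_def using I J interval by blast
  then show ?thesis by (simp add: z_def[abs_def])
qed

section \<open>Geodesics as straight lines in Legendre coordinates\<close>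

lemma HSD_imp_geodesic:
  assumes sol: "HSD c x0 J y"
  shows "geodesic F g J y"
  unfolding geodesic_def
proof (intro conjI ballI)
  show "open J" "is_interval J" "y ` J \<subseteq> F"
    using sol by (auto simp: HSD_solution_def)
  have "\<forall>t\<in>J. \<exists>D. (y has_vector_derivative D) (at t) \<and> D \<in> ker A \<and> P (Hess h (y t) *v D) = - P c"
    using HSD_velocity[OF sol] by blast
  then obtain D where D: "\<And>t. t \<in> J \<Longrightarrow> (y has_vector_derivative D t) (at t)"
    "\<And>t. t \<in> J \<Longrightarrow> D t \<in> ker A" "\<And>t. t \<in> J \<Longrightarrow> P (Hess h (y t) *v D t) = - P c"
    by metis
  have C: "y t \<in> C" if "t \<in> J" for t
    using sol that by (simp add: HSD_solution_def feasible_in_C)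
  have conty: "continuous_on J y"
    by (rule continuous_at_imp_continuous_on) (use D(1) has_vector_derivative_continuous in blast)
  have "continuous_on J D"
  proof (rule continuous_on_linear_solution)
    show "continuous_on J (\<lambda>t. d\<Phi> (y t))"
      by (rule continuous_on_compose2[OF continuous_on_d\<Phi> conty]) (use C in auto)
    show "d\<Phi> (y t) *v D t = (\<lambda>_. - P c) t" if "t \<in> J" for t
      using D(2,3)[OF that] by (simp add: d\<Phi>_tangent)
  qed (auto intro!: invertible_d\<Phi> C)
  then show "y C1_differentiable_on J"
    unfolding C1_differentiable_on_def using D(1) by blast
  have speed: "curve_speed g y t = norm (P c)" if "t \<in> J" for t
    using D(3)[OF that] by (simp add: curve_speed_eq[OF D(1)[OF that]])
  then show "\<exists>k. \<forall>t\<in>J. curve_speed g y t = k" by blast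
  \<comment> \<open>The image under \<open>\<phi>\<close> is a straight line, so its length is that
    of its chord and no competitor is shorter. This holds on every compact subinterval of
    \<open>J\<close>, so the radius \<open>1\<close> chosen below is arbitrary.\<close>
  have "curve_length g s r y \<le> curve_length g s r p"
    if sr: "s < r" "{s..r} \<subseteq> J" and p: "p C1_differentiable_on {s..r}" "p ` {s..r} \<subseteq> F"
      "p s = y s" "p r = y r" for s r p
  proof -
    have sJ: "s \<in> J" "r \<in> J" using sr by auto
    have "curve_length g s r y = norm (P c) * (r - s)"
      using sr speed by (intro curve_length_constant_speed) auto
    also have "\<dots> = norm (\<phi> (p r) - \<phi> (p s))"
      using sr by (simp add: p HSD_legendre[OF sol sJ])
    also have "\<dots> \<le> curve_length g s r p"
      using sr p feasible_in_C by (intro curve_length_ge_chord) auto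
    finally show ?thesis .
  qed
  then show "\<exists>e>0. \<forall>s r. s < r \<and> {s..r} \<subseteq> J \<inter> ball t e \<longrightarrow>
      (\<forall>p. p C1_differentiable_on {s..r} \<and> p ` {s..r} \<subseteq> F \<and> p s = y s \<and> p r = y r \<longrightarrow>
        curve_length g s r y \<le> curve_length g s r p)" for t
    by (intro exI[of _ 1]) simp
qed

text \<open>On a short interval the length \<open>k * (r - s)\<close> lies between the chord of the
  image under \<open>\<phi>\<close>, a lower bound for every curve, and the length of the lifted
  chord, an admissible competitor. The two bounds coincide.\<close>

lemma geodesic_legendre_distance:
  assumes geo: "geodesic F g J y" and k: "\<And>t. t \<in> J \<Longrightarrow> curve_speed g y t = k" and t: "t \<in> J"
  obtains d where "d > 0" "ball t d \<subseteq> J"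
    "\<And>s r. s \<in> ball t d \<Longrightarrow> r \<in> ball t d \<Longrightarrow> s < r \<Longrightarrow> norm (\<phi> (y r) - \<phi> (y s)) = k * (r - s)"
proof -
  have J: "open J" and yF: "\<And>t. t \<in> J \<Longrightarrow> y t \<in> F" and C1: "y C1_differentiable_on J"
    using geo by (auto simp: geodesic_def)
  obtain e where e: "e > 0" and min: "\<And>s r p. s < r \<Longrightarrow> {s..r} \<subseteq> J \<inter> ball t e \<Longrightarrow>
      p C1_differentiable_on {s..r} \<Longrightarrow> p ` {s..r} \<subseteq> F \<Longrightarrow> p s = y s \<Longrightarrow> p r = y r \<Longrightarrow>
      curve_length g s r y \<le> curve_length g s r p"
    using geo t unfolding geodesic_def by metis
  have "\<Phi> (y t) \<in> \<Phi> ` C" using yF[OF t] feasible_in_C by blast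
  then obtain \<epsilon> where \<epsilon>: "\<epsilon> > 0" "ball (\<Phi> (y t)) \<epsilon> \<subseteq> \<Phi> ` C"
    using open_\<Phi>_image open_contains_ball by blast
  have "continuous_on J (\<lambda>t. \<Phi> (y t))"
    by (rule continuous_on_compose2[OF continuous_on_\<Phi> C1_differentiable_imp_continuous_on[OF C1]])
       (use yF feasible_in_C in auto)
  then have "open (J \<inter> (\<lambda>t. \<Phi> (y t)) -` ball (\<Phi> (y t)) \<epsilon>)"
    by (rule continuous_open_preimage) (simp_all add: J)
  then have "open (J \<inter> (\<lambda>t. \<Phi> (y t)) -` ball (\<Phi> (y t)) \<epsilon> \<inter> ball t e)"
    by (rule open_Int[OF _ open_ball])
  moreover have "t \<in> J \<inter> (\<lambda>t. \<Phi> (y t)) -` ball (\<Phi> (y t)) \<epsilon> \<inter> ball t e"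
    using t e \<epsilon> by simp
  ultimately obtain d where d: "d > 0"
    "ball t d \<subseteq> J \<inter> (\<lambda>t. \<Phi> (y t)) -` ball (\<Phi> (y t)) \<epsilon> \<inter> ball t e"
    by (rule openE)
  show thesis
  proof (rule that[OF d(1)])
    show "ball t d \<subseteq> J" using d by blast
    fix s r assume sr: "s \<in> ball t d" "r \<in> ball t d" "s < r"
    have sub: "{s..r} \<subseteq> ball t d"
      using sr by (auto simp: dist_real_def)
    then have srJ: "{s..r} \<subseteq> J \<inter> ball t e" using d by blast
    \<comment> \<open>Balls are convex: the chord stays in the image of \<open>C\<close> and can be
      lifted.\<close>
    have "closed_segment (\<Phi> (y s)) (\<Phi> (y r)) \<subseteq> ball (\<Phi> (y t)) \<epsilon>"
      using d sr by (intro closed_segment_subset) auto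
    then have seg: "closed_segment (\<Phi> (y s)) (\<Phi> (y r)) \<subseteq> \<Phi> ` C" using \<epsilon> by blast
    have F: "y s \<in> F" "y r \<in> F" using sr d yF by blast+
    obtain p where p: "p C1_differentiable_on {s..r}" "p ` {s..r} \<subseteq> F" "p s = y s" "p r = y r"
      "curve_length g s r p = norm (\<phi> (y r) - \<phi> (y s))"
      using segment_curve[OF sr(3) F seg] .
    have len: "curve_length g s r y = k * (r - s)"
      using sr(3) srJ k by (intro curve_length_constant_speed) auto
    have "norm (\<phi> (y r) - \<phi> (y s)) \<le> curve_length g s r y"
    proof (rule curve_length_ge_chord)
      show "y C1_differentiable_on {s..r}"
        using C1 srJ by (auto intro: C1_differentiable_on_subset)
    qed (use sr(3) srJ yF feasible_in_C in auto)
    moreover have "curve_length g s r y \<le> curve_length g s r p"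
      using min[OF sr(3) srJ p(1-4)] .
    ultimately show "norm (\<phi> (y r) - \<phi> (y s)) = k * (r - s)"
      using p(5) len by linarith
  qed
qed

text \<open>Distances proportional to time force the image under \<open>\<phi>\<close> to be locally
  a chord traversed at constant velocity. Local constancy extends to \<open>J\<close> by
  connectedness.\<close>

lemma geodesic_legendre_velocity:
  assumes geo: "geodesic F g J y" and t: "s \<in> J" "t \<in> J"
    and D: "\<And>t. t \<in> J \<Longrightarrow> (y has_vector_derivative D t) (at t)"
  shows "P (Hess h (y t) *v D t) = P (Hess h (y s) *v D s)"
proof -
  define E where "E t = P (Hess h (y t) *v D t)" for t
  have "\<exists>k. \<forall>t\<in>J. curve_speed g y t = k"
    using geo by (simp add: geodesic_def)
  then obtain k where k: "\<And>t. t \<in> J \<Longrightarrow> curve_speed g y t = k"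
    by blast
  have J: "connected J" "open J" and yF: "\<And>t. t \<in> J \<Longrightarrow> y t \<in> F"
    using geo by (auto simp: geodesic_def is_interval_connected_1)
  have "\<exists>d>0. \<forall>t'\<in>ball t d. E t = E t'" if t: "t \<in> J" for t
  proof -
    obtain d where d: "d > 0" "ball t d \<subseteq> J" and dist: "\<And>s r. s \<in> ball t d \<Longrightarrow> r \<in> ball t d \<Longrightarrow>
        s < r \<Longrightarrow> norm (\<phi> (y r) - \<phi> (y s)) = k * (r - s)"
      using geodesic_legendre_distance[OF geo k t] by blast
    have "E t = E t'" if t': "t' \<in> ball t d" for t'
    proof -
      \<comment> \<open>Both \<open>t\<close> and \<open>t'\<close> are to lie strictly between some
        \<open>s\<close> and \<open>r\<close> of the ball, so that the two velocities equal the
        slope of one chord.\<close>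
      have bounds: "t - d < min t t'" "max t t' < t + d"
        using t' d(1) by (auto simp: dist_real_def)
      obtain s where s: "t - d < s" "s < min t t'"
        using dense[OF bounds(1)] by blast
      obtain r where r: "max t t' < r" "r < t + d"
        using dense[OF bounds(2)] by blast
      have S: "s \<in> ball t d" "r \<in> ball t d" "{s<..<r} \<subseteq> ball t d"
        using s r by (auto simp: dist_real_def)
      have "E u = (1 / (r - s)) *\<^sub>R (\<phi> (y r) - \<phi> (y s))" if u: "s < u" "u < r" for u
      proof (rule distance_affine_imp_constant_velocity[OF dist S u])
        have "u \<in> J" using u S d by auto
        then show "((\<lambda>t. \<phi> (y t)) has_vector_derivative E u) (at u)"
          unfolding E_def by (intro legendre_curve_has_vector_derivative D feasible_in_C yF)
      qed
      from this[of t] this[of t'] show ?thesis using s r by simp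
    qed
    then show ?thesis using d by blast
  qed
  then have "\<forall>t\<in>J. eventually (\<lambda>t'. E t = E t') (at t within J)"
    by (auto simp: eventually_at dist_commute mem_ball) (meson mem_ball)
  then show ?thesis
    using connected_local_const[OF J(1) t(2,1)] by (simp add: E_def)
qed

text \<open>Both kinds of curves have images under \<open>\<phi>\<close> with constant velocity, and
  the condition on \<open>v\<close> makes it \<open>- P c\<close>. The interval is the same on both
  sides, so maximality transfers as well.\<close>

lemma geodesic_through_iff_HSD:
  assumes x0: "x0 \<in> F" and v: "v \<in> ker A" "P (Hess h x0 *v v) = - P c"
  shows "geodesic_through F g x0 v J y \<longleftrightarrow> HSD c x0 J y"
proof
  assume sol: "HSD c x0 J y"
  then have 0: "0 \<in> J" "y 0 = x0" by (auto simp: HSD_solution_def)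
  have "v = - riem_grad A (Hess h) (\<lambda>y. c \<bullet> y) x0"
    using v by (intro tangent_eq_riem_grad feasible_in_C x0) (simp_all add: gradient_inner)
  then have "(y has_vector_derivative v) (at 0)"
    using sol 0 by (auto simp: HSD_solution_def)
  with 0 show "geodesic_through F g x0 v J y"
    using HSD_imp_geodesic[OF sol] by (simp add: geodesic_through_def)
next
  assume "geodesic_through F g x0 v J y"
  then have geo: "geodesic F g J y" and 0: "0 \<in> J" "y 0 = x0" "(y has_vector_derivative v) (at 0)"
    by (auto simp: geodesic_through_def)
  then have J: "open J" "is_interval J" and yF: "\<And>t. t \<in> J \<Longrightarrow> y t \<in> F"
    and C1: "y C1_differentiable_on J"
    by (auto simp: geodesic_def)
  obtain D where D: "\<And>t. t \<in> J \<Longrightarrow> (y has_vector_derivative D t) (at t)"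
    using C1 unfolding C1_differentiable_on_def by blast
  have "D 0 = v"
    using vector_derivative_unique_at[OF D[OF 0(1)] 0(3)] .
  have "D t = - riem_grad A (Hess h) (\<lambda>y. c \<bullet> y) (y t)" if t: "t \<in> J" for t
  proof (rule tangent_eq_riem_grad)
    show "y t \<in> C" using yF[OF t] by (rule feasible_in_C)
    show "D t \<in> ker A"
      using feasible_curve_tangent[OF J(1) t yF D[OF t]] .
    show "P (Hess h (y t) *v D t) = - P (gradient (\<lambda>y. c \<bullet> y) (y t))"
      using geodesic_legendre_velocity[OF geo 0(1) t D] v(2) \<open>D 0 = v\<close> 0(2)
      by (simp add: gradient_inner)
  qed
  then show "HSD c x0 J y"
    unfolding HSD_solution_def using J 0 yF D by auto
qed

text \<open>The Riemannian gradient of the linear function is a preimage of \<open>P c\<close>, so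
  \<open>inv_into\<close> returns a genuine preimage.\<close>

lemma inv_d_legendre_coord:
  assumes y: "y \<in> C"
  shows "inv_into (ker A) (d_legendre_coord A h y) (P c) \<in> ker A"
    and "P (Hess h y *v inv_into (ker A) (d_legendre_coord A h y) (P c)) = P c"
proof -
  have "P c \<in> d_legendre_coord A h y ` ker A"
    using riem_grad_tangent[OF y, of "\<lambda>y. c \<bullet> y"]
    by (auto simp: d_legendre_coord_eq[OF y] gradient_inner image_iff intro: bexI[rotated])
  from inv_into_into[OF this] f_inv_into_f[OF this]
  show "inv_into (ker A) (d_legendre_coord A h y) (P c) \<in> ker A"
    "P (Hess h y *v inv_into (ker A) (d_legendre_coord A h y) (P c)) = P c"
    by (simp_all add: d_legendre_coord_eq[OF y])
qed

end

section \<open>Initial velocity, maximality and uniqueness of the geodesic\<close>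

theorem theorem5p2:
  fixes A :: "real^'n^'m" and b :: "real^'m" and C :: "(real^'n) set"
    and h :: "real^'n \<Rightarrow> ereal" and x0 c v :: "real^'n"
    and I :: "real set" and x :: "real \<Rightarrow> real^'n"
  assumes "CARD('m) < CARD('n)" and "rank A = CARD('m)" and "b \<in> range ((*v) A)"
    and "C \<noteq> {}" and "open C" and "convex C" and "feasible A b C \<noteq> {}"
    and "h \<in> Gamma0" and "legendre_type h" and "interior (edom h) = C"
    and "C2_on C (fin_part h)" and "\<forall>y\<in>C. pos_def_matrix (Hess h y)"
    and "locally_lipschitz_on C (Hess h)"
    and "x0 \<in> feasible A b C"
    and "v = - inv_into (ker A) (d_legendre_coord A h x0) (orth_proj (ker A) c)"
    and "maximal_curve (HSD_solution A b C h (\<lambda>y. c \<bullet> y) x0) I x"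
  shows "v = - (matrix_sqrt (matrix_inv (Hess h x0)) *v
             orth_proj ((*v) (matrix_sqrt (Hess h x0)) ` ker A)
               (matrix_sqrt (matrix_inv (Hess h x0)) *v orth_proj (ker A) c))
    \<and> (\<forall>y\<in>feasible A b C. \<forall>u\<in>ker A. \<forall>w\<in>ker A.
          H2_metric A h y u w = d_legendre_coord A h y u \<bullet> d_legendre_coord A h y w)
    \<and> maximal_curve (geodesic_through (feasible A b C) (H2_metric A h) x0 v) I x
    \<and> (\<forall>J \<gamma>. maximal_curve (geodesic_through (feasible A b C) (H2_metric A h) x0 v) J \<gamma> \<longrightarrow>
          J = I \<and> (\<forall>t\<in>I. \<gamma> t = x t))"
proof -
  interpret legendre_setting A b C h
    using assms by unfold_locales auto
  define w where "w = inv_into (ker A) (d_legendre_coord A h x0) (P c)"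
  have x0: "x0 \<in> C" using assms(14) by (rule feasible_in_C)
  have w: "w \<in> ker A" "P (Hess h x0 *v w) = P c"
    unfolding w_def by (rule inv_d_legendre_coord[OF x0])+
  have vw: "v = - w" using assms(15) by (simp add: w_def)
  have v: "v \<in> ker A" "P (Hess h x0 *v v) = - P c"
    using w by (simp_all add: vw subspace_neg[OF subspace_ker] linear_neg[OF linear_P]
        linear_neg[OF matrix_vector_mul_linear])
  \<comment> \<open>The two predicates coincide on all intervals and curves, so rewriting with this
    equation turns maximal geodesics into maximal solutions.\<close>
  have geo: "geodesic_through F g x0 v = HSD c x0"
    by (intro ext geodesic_through_iff_HSD[OF assms(14) v])
  have root: "matrix_sqrt (matrix_inv (Hess h x0)) *v
      orth_proj ((*v) (matrix_sqrt (Hess h x0)) ` ker A)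
        (matrix_sqrt (matrix_inv (Hess h x0)) *v P c) = w"
  proof (rule orth_proj_matrix_sqrt[OF pos_def[OF x0] subspace_ker w(1)])
    show "(Hess h x0 *v w) \<bullet> z = P c \<bullet> z" if "z \<in> ker A" for z
      using P_inner[OF that, of "Hess h x0 *v w"] w(2) by simp
  qed
  have metric: "H2_metric A h y u z = d_legendre_coord A h y u \<bullet> d_legendre_coord A h y z"
    if "y \<in> F" for y u z
    by (simp add: H2_metric_def d_legendre_coord_eq[OF feasible_in_C[OF that]])
  have unique: "J = I \<and> (\<forall>t\<in>I. \<gamma> t = x t)" if \<gamma>: "maximal_curve (HSD c x0) J \<gamma>" for J \<gamma>
  proof -
    have sol: "HSD c x0 I x" "HSD c x0 J \<gamma>"
      using \<gamma> assms(16) by (auto simp: maximal_curve_def)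
    \<comment> \<open>The glued curve extends both solutions, so each maximal interval absorbs the
      other.\<close>
    have "I \<union> J = I"
      by (rule maximal_curveD[OF assms(16)], rule HSD_union[OF sol]) auto
    moreover have "J \<union> I = J"
      by (rule maximal_curveD[OF \<gamma>], rule HSD_union[OF sol(2,1)]) auto
    ultimately have "J = I" by blast
    then show ?thesis using HSD_solutions_agree[OF sol] by auto
  qed
  show ?thesis
    unfolding geo root
    using vw metric assms(16) unique by blast
qed

end
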